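(* Let $f:\mathbb{R}^{n\times p}\to\mathbb{R}$ be locally Lipschitz continuous and suppose: (A1) $f$ is path differentiable; (A2) the set $\{f(X):X\in\mathcal{S}_{n,p},\ 0\in\partial_{\mathcal P}f(X)\}$ has empty interior in $\mathbb{R}$. Let $\mathcal{D}_f$ be a conservative field that admits $f$ as its potential function, let $\beta>0$, let $X_0\in\Omega_{1/6}$, and let $\{X_k\}_{k\ge0}$ be generated by $$X_{k+1}=X_k-\eta_k\left(D_k+\beta X_k(X_k^\top X_k-I_p)\right),\qquad k\ge0,$$ where $D_k\in\mathbb{R}^{n\times p}$ and $\eta_k\in\mathbb{R}$ satisfy: (C1) for every $k\ge0$, $D_k=G_k+E_k$, where $\lim_{N\to\infty}\sum_{k=0}^N\eta_kE_k$ exists, and for any subsequence $\{X_{k_j}\}$ converging to some $\tilde X$, $$\lim_{N\to\infty}\mathrm{dist}\Big(\frac1N\sum_{j=1}^NG_{k_j},\ \mathcal{J}_{\mathcal A}(\tilde X)[\mathcal{D}_f(\mathcal{A}(\tilde X))]\Big)=0;$$ (C2) there are constants $\tilde M,\hat M$ such that $\sup_{k\ge0}\|D_k\|_{\mathrm F}\le\tilde M$ and $\sup\{\|D\|_{\mathrm F}:X\in\Omega_{1/6},\ D\in\mathcal{D}_f(X)\}\le\hat M$, and $\beta\ge\max\{16M_1,60\tilde M,16\hat M\}$; (C3) $\eta_k>0$ for all $k$, $\sum_{k=0}^\infty\eta_k=\infty$, $\sum_{k=0}^\infty\eta_k^2<\infty$, and $\sup_{k\ge0}\eta_k\le\frac1{2\beta}$;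 (C4) the set $\{f(X):X\in\mathcal{S}_{n,p},\ 0\in\mathcal{J}_{\mathcal A}(X)[\mathcal{D}_f(X)]\}$ has empty interior in $\mathbb{R}$. Then $\{h(X_k)\}$ converges and every cluster point $X^*$ of $\{X_k\}$ lies in the set $\{X\in\mathcal{S}_{n,p}:0\in\mathcal{J}_{\mathcal A}(X)[\mathcal{D}_f(X)]\}$.
   Context: $\|\cdot\|_{\mathrm F}$ is the Frobenius norm, $\langle X,Y\rangle=\mathrm{tr}(X^\top Y)$, $\mathrm{dist}(Z,S)=\inf_{D\in S}\|Z-D\|_{\mathrm F}$, $\Phi(M)=\frac12(M+M^\top)$. $\partial$ is the Clarke subdifferential. $\mathcal{S}_{n,p}=\{X\in\mathbb{R}^{n\times p}:X^\top X=I_p\}$; $\Omega_r=\{X\in\mathbb{R}^{n\times p}:\|X^\top X-I_p\|_{\mathrm F}\le r\}$; for $X\in\mathcal{S}_{n,p}$, $\partial_{\mathcal P}f(X)=\{W-X\Phi(X^\top W):W\in\partial f(X)\}$. $M_1=\sup\{\|W\|_{\mathrm F}:X\in\Omega_1,\ W\in\partial f(X)\}$. $\mathcal{A}(X)=\frac18X\left(15I_p-10X^\top X+3(X^\top X)^2\right)$; $\mathcal{J}_{\mathcal A}(X)$ is the derivative of $\mathcal{A}$ at $X$ as a linear map on $\mathbb{R}^{n\times p}$, and $\mathcal{J}_{\mathcal A}(X)[\mathcal F]=\{\mathcal{J}_{\mathcal A}(X)[D]:D\in\mathcal F\}$ for a set $\mathcal F$. $h(X)=f(\mathcal{A}(X))+\frac\beta4\|X^\top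 X-I_p\|_{\mathrm F}^2$. $f$ is path differentiable means that $f$ admits a chain rule: for any absolutely continuous curve $\gamma:[0,\infty)\to\mathbb{R}^{n\times p}$, for almost every $t\ge0$, $(f\circ\gamma)'(t)=\langle V,\gamma'(t)\rangle$ for all $V\in\partial f(\gamma(t))$. Conservative field: a set-valued map $\mathcal{D}$ from $\mathbb{R}^{n\times p}$ to subsets of $\mathbb{R}^{n\times p}$ with closed graph and nonempty compact values such that for any absolutely continuous curve $\gamma:[0,1]\to\mathbb{R}^{n\times p}$ with $\gamma(0)=\gamma(1)$, $\int_0^1\max_{v\in\mathcal{D}(\gamma(t))}\langle\gamma'(t),v\rangle\,\mathrm{d}t=0$ (Lebesgue integral). $\mathcal{D}$ admits $f$ as its potential function if for all $X_0,X$ and every absolutely continuous $\gamma:[0,1]\to\mathbb{R}^{n\times p}$ with $\gamma(0)=X_0$, $\gamma(1)=X$, $f(X)=f(X_0)+\int_0^1\max_{v\in\mathcal{D}(\gamma(t))}\langle\gamma'(t),v\rangle\,\mathrm{d}t=f(X_0)+\int_0^1\min_{v\in\mathcal{D}(\gamma(t))}\langle\gamma'(t),v\rangle\,\mathrm{d}t$. *)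

theory Defs
  imports "HOL-Analysis.Analysis"
begin

definition locally_lipschitz :: "('a::metric_space \<Rightarrow> 'b::metric_space) \<Rightarrow> bool" where
  "locally_lipschitz f \<longleftrightarrow> (\<forall>x. \<exists>u>0. \<exists>L. L-lipschitz_on (cball x u) f)"

text \<open>The base point \<open>y\<close> ranges over full neighbourhoods of \<open>x\<close>, including \<open>y = x\<close>.
  Working in \<^typ>\<open>ereal\<close> makes the upper limit meaningful for every function.\<close>

definition clarke_dir_deriv :: "('a::real_inner \<Rightarrow> real) \<Rightarrow> 'a \<Rightarrow> 'a \<Rightarrow> ereal" where
  "clarke_dir_deriv f x d =
     Limsup (nhds x \<times>\<^sub>F at_right (0::real)) (\<lambda>(y, t). ereal ((f (y + t *\<^sub>R d) - f y) / t))"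

definition clarke_subdiff :: "('a::real_inner \<Rightarrow> real) \<Rightarrow> 'a \<Rightarrow> 'a set" where
  "clarke_subdiff f x = {w. \<forall>d. ereal (w \<bullet> d) \<le> clarke_dir_deriv f x d}"

text \<open>The epsilon-delta definition: \<open>d\<close> is a finite family of non-overlapping compact
  intervals contained in \<open>S\<close>, with end points \<open>Inf k\<close> and \<open>Sup k\<close> for \<open>k \<in> d\<close>.\<close>

definition abs_continuous_on :: "real set \<Rightarrow> (real \<Rightarrow> 'a::real_normed_vector) \<Rightarrow> bool" where
  "abs_continuous_on S \<gamma> \<longleftrightarrow>
     (\<forall>\<epsilon>>0. \<exists>\<delta>>0. \<forall>d T. d division_of T \<and> T \<subseteq> S \<and> (\<Sum>k\<in>d. Sup k - Inf k) < \<delta> \<longrightarrow>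
        (\<Sum>k\<in>d. norm (\<gamma> (Sup k) - \<gamma> (Inf k))) < \<epsilon>)"

definition path_differentiable :: "('a::euclidean_space \<Rightarrow> real) \<Rightarrow> bool" where
  "path_differentiable f \<longleftrightarrow>
     (\<forall>\<gamma>. abs_continuous_on {0..} \<gamma> \<longrightarrow>
       (AE t in lebesgue. 0 \<le> t \<longrightarrow>
         (\<exists>v. (\<gamma> has_vector_derivative v) (at t within {0..}) \<and>
              (\<forall>V\<in>clarke_subdiff f (\<gamma> t).
                 ((\<lambda>s. f (\<gamma> s)) has_real_derivative (V \<bullet> v)) (at t within {0..})))))"

text \<open>An absolutely continuous curve is differentiable almost everywhere, so the values of
  \<^const>\<open>vector_derivative\<close> at the remaining times do not influence the integrals below. For
  nonempty compact \<open>D x\<close> the supremum and infimum are a maximum and a minimum.\<close>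

definition max_speed :: "('a::euclidean_space \<Rightarrow> 'a set) \<Rightarrow> (real \<Rightarrow> 'a) \<Rightarrow> real \<Rightarrow> real" where
  "max_speed D \<gamma> t = (SUP v\<in>D (\<gamma> t). vector_derivative \<gamma> (at t within {0..1}) \<bullet> v)"

definition min_speed :: "('a::euclidean_space \<Rightarrow> 'a set) \<Rightarrow> (real \<Rightarrow> 'a) \<Rightarrow> real \<Rightarrow> real" where
  "min_speed D \<gamma> t = (INF v\<in>D (\<gamma> t). vector_derivative \<gamma> (at t within {0..1}) \<bullet> v)"

definition conservative_field :: "('a::euclidean_space \<Rightarrow> 'a set) \<Rightarrow> bool" where
  "conservative_field D \<longleftrightarrow>
     closed {(x, v). v \<in> D x} \<and>
     (\<forall>x. D x \<noteq> {} \<and> compact (D x)) \<and>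
     (\<forall>\<gamma>. abs_continuous_on {0..1} \<gamma> \<and> \<gamma> 0 = \<gamma> 1 \<longrightarrow>
        has_bochner_integral (lebesgue_on {0..1}) (max_speed D \<gamma>) 0)"

definition admits_potential :: "('a::euclidean_space \<Rightarrow> 'a set) \<Rightarrow> ('a \<Rightarrow> real) \<Rightarrow> bool" where
  "admits_potential D f \<longleftrightarrow>
     (\<forall>x\<^sub>0 x \<gamma>. abs_continuous_on {0..1} \<gamma> \<and> \<gamma> 0 = x\<^sub>0 \<and> \<gamma> 1 = x \<longrightarrow>
        integrable (lebesgue_on {0..1}) (max_speed D \<gamma>) \<and>
        integrable (lebesgue_on {0..1}) (min_speed D \<gamma>) \<and>
        f x = f x\<^sub>0 + (LINT t|lebesgue_on {0..1}. max_speed D \<gamma> t) \<and>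
        f x = f x\<^sub>0 + (LINT t|lebesgue_on {0..1}. min_speed D \<gamma> t))"

text \<open>An \<open>n \<times> p\<close> matrix is an element of \<^typ>\<open>real^'p^'n\<close>. The norm and inner product of this
  type are the Frobenius norm and \<open>trace (X\<^sup>T Y)\<close>:\<close>

lemma inner_matrix_eq_trace:
  fixes X Y :: "real^'p^'n"
  shows "X \<bullet> Y = trace (transpose X ** Y)"
  unfolding inner_vec_def trace_def matrix_matrix_mult_def transpose_def
  by (simp add: sum.swap[of _ "UNIV :: 'n set"])

lemma norm_matrix_eq_trace:
  fixes X :: "real^'p^'n"
  shows "norm X = sqrt (trace (transpose X ** X))"
  by (simp add: norm_eq_sqrt_inner inner_matrix_eq_trace)

definition stiefel :: "(real^'p^'n) set" where
  "stiefel = {X. transpose X ** X = mat 1}"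

definition \<Omega> :: "real \<Rightarrow> (real^'p^'n) set" where
  "\<Omega> r = {X. norm (transpose X ** X - mat 1) \<le> r}"

definition \<Phi> :: "real^'p^'p \<Rightarrow> real^'p^'p" where
  "\<Phi> M = (1/2) *\<^sub>R (M + transpose M)"

definition projected_subdiff :: "(real^'p^'n \<Rightarrow> real) \<Rightarrow> real^'p^'n \<Rightarrow> (real^'p^'n) set" where
  "projected_subdiff f X = {W - X ** \<Phi> (transpose X ** W) |W. W \<in> clarke_subdiff f X}"

definition M\<^sub>1 :: "(real^'p^'n \<Rightarrow> real) \<Rightarrow> real" where
  "M\<^sub>1 f = Sup {norm W |X W. X \<in> \<Omega> 1 \<and> W \<in> clarke_subdiff f X}"

definition \<A> :: "real^'p^'n \<Rightarrow> real^'p^'n" where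
  "\<A> X = (1/8) *\<^sub>R (X ** (15 *\<^sub>R mat 1 - 10 *\<^sub>R (transpose X ** X)
                         + 3 *\<^sub>R ((transpose X ** X) ** (transpose X ** X))))"

definition \<J>\<^sub>\<A> :: "real^'p^'n \<Rightarrow> real^'p^'n \<Rightarrow> real^'p^'n" where
  "\<J>\<^sub>\<A> X = frechet_derivative \<A> (at X)"

definition penalty :: "(real^'p^'n \<Rightarrow> real) \<Rightarrow> real \<Rightarrow> real^'p^'n \<Rightarrow> real" where
  "penalty f \<beta> X = f (\<A> X) + \<beta> / 4 * (norm (transpose X ** X - mat 1))\<^sup>2"

end

theory Submission
  imports Defs "HOL-Complex_Analysis.Great_Picard"
begin

text \<open>The limit curves of the iteration, obtained from the Arzela-Ascoli theorem, solve the differential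
  inclusion \<open>- x' \<in> \<J>\<^sub>\<A>(x)[D\<^sub>f(\<A>(x))] + \<beta> x (x\<^sup>T x - I)\<close>. Since \<open>\<A>\<close> is a gradient, \<open>\<J>\<^sub>\<A>(x)\<close> is
  symmetric, so the right-hand side is conservative with potential \<open>h\<close> and \<open>h\<close> decreases along a limit
  curve at rate \<open>\<parallel>x'\<parallel>\<^sup>2\<close>. A limit curve along which \<open>h\<close> does not decrease is therefore constant, and its
  value is stationary. If \<open>h(X\<^sub>k)\<close> oscillated, then upcrossings of a noncritical value would produce such a
  curve; if \<open>h(X\<^sub>k)\<close> converges, then every cluster point is the start of one. On \<open>\<Omega>(1/6)\<close>, which the
  iteration never leaves, stationary points are feasible because \<open>\<J>\<^sub>\<A>(x)\<close> maps the normal direction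
  \<open>x c\<close>, \<open>c = x\<^sup>T x - I\<close>, to \<open>(15/8) x c\<^sup>3\<close>, which is of third order in the infeasibility.\<close>

section \<open>Sequences and their averages\<close>

lemma frequently_if_eventually_subseq:
  assumes "\<forall>\<^sub>F n in sequentially. P (r n)" and "filterlim r at_top sequentially"
  shows "\<exists>\<^sub>F k in sequentially. P k"
  unfolding frequently_def
proof
  assume "\<forall>\<^sub>F k in sequentially. \<not> P k"
  from eventually_compose_filterlim[OF this assms(2)] assms(1)
  have "\<forall>\<^sub>F n::nat in sequentially. False" by eventually_elim simp
  then show False by simp
qed

lemma greedy_subsequence:
  fixes g :: "nat \<Rightarrow> 'a::comm_monoid_add"
  assumes "\<And>n s. \<exists>\<^sub>F k in sequentially. Q n s k"
  shows "\<exists>r :: nat \<Rightarrow> nat. strict_mono r \<and> (\<forall>n. Q n (\<Sum>j<n. g (r j)) (r n))"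
proof -
  have arbitrarily_late: "\<exists>k>N. Q n s k" for N n s
    using assms[of n s] unfolding frequently_sequentially by (meson Suc_le_eq)
  have "\<exists>z. \<forall>n. (Q n (snd (z n)) (fst (z n)) \<and> (n = 0 \<longrightarrow> snd (z n) = 0)) \<and>
     (fst (z n) < fst (z (Suc n)) \<and> snd (z (Suc n)) = snd (z n) + g (fst (z n)))"
  proof (rule dependent_nat_choice)
    obtain k where "Q 0 0 k" using arbitrarily_late by blast
    then show "\<exists>x. Q 0 (snd x) (fst x) \<and> (0 = (0::nat) \<longrightarrow> snd x = 0)"
      by (intro exI[of _ "(k, 0)"]) auto
  next
    fix x :: "nat \<times> 'a" and n
    obtain k where "k > fst x" "Q (Suc n) (snd x + g (fst x)) k" using arbitrarily_late by blast
    then show "\<exists>y. (Q (Suc n) (snd y) (fst y) \<and> (Suc n = 0 \<longrightarrow> snd y = 0)) \<and>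
           fst x < fst y \<and> snd y = snd x + g (fst x)"
      by (intro exI[of _ "(k, snd x + g (fst x))"]) auto
  qed
  then obtain z where z: "\<And>n. Q n (snd (z n)) (fst (z n))" "snd (z 0) = 0"
    "\<And>n. fst (z n) < fst (z (Suc n))" "\<And>n. snd (z (Suc n)) = snd (z n) + g (fst (z n))"
    by metis
  have "snd (z n) = (\<Sum>j<n. g (fst (z j)))" for n
    by (induction n) (auto simp: z)
  then show ?thesis
    using z by (intro exI[of _ "\<lambda>n. fst (z n)"]) (auto simp: strict_mono_Suc_iff)
qed

lemma unbounded_near_cluster_point:
  fixes X :: "nat \<Rightarrow> 'a::metric_space" and U :: "nat \<Rightarrow> 'b::real_normed_vector"
  assumes "compact K" and X_in: "\<And>k. X k \<in> K" and unbounded: "\<not> bounded (range U)"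
  shows "\<exists>x. \<forall>e>0. \<forall>R. \<exists>\<^sub>F k in sequentially. dist (X k) x < e \<and> R \<le> norm (U k)"
proof -
  have "\<exists>\<^sub>F k in sequentially. R \<le> norm (U k)" for R
    unfolding frequently_def
  proof
    assume "\<forall>\<^sub>F k in sequentially. \<not> R \<le> norm (U k)"
    then have "\<forall>\<^sub>F k in sequentially. norm (U k) \<le> R" by eventually_elim simp
    then have "Bfun U sequentially" by (rule BfunI)
    then show False using unbounded by (simp add: Bseq_eq_bounded)
  qed
  then obtain r :: "nat \<Rightarrow> nat" where r: "strict_mono r" "\<And>n. real n \<le> norm (U (r n))"
    using greedy_subsequence[of "\<lambda>n _ k. real n \<le> norm (U k)" U] by blast
  obtain x l where l: "strict_mono (l :: nat \<Rightarrow> nat)" and x: "((\<lambda>n. X (r n)) \<circ> l) \<longlonglongrightarrow> x"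
    using seq_compactE[OF compact_imp_seq_compact[OF \<open>compact K\<close>], of "\<lambda>n. X (r n)"] X_in by metis
  have "\<exists>\<^sub>F k in sequentially. dist (X k) x < e \<and> R \<le> norm (U k)" if "e > 0" for e R
  proof (rule frequently_if_eventually_subseq)
    have "\<forall>\<^sub>F n in sequentially. R \<le> real (l n)"
      using filterlim_compose[OF filterlim_real_sequentially filterlim_subseq[OF l]]
      by (simp add: filterlim_at_top)
    moreover have "\<forall>\<^sub>F n in sequentially. dist (X (r (l n))) x < e"
      using tendstoD[OF x that] by simp
    ultimately show "\<forall>\<^sub>F n in sequentially. dist (X (r (l n))) x < e \<and> R \<le> norm (U (r (l n)))"
      by eventually_elim (use r(2) order_trans in blast)
    show "filterlim (\<lambda>n. r (l n)) at_top sequentially"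
      by (rule filterlim_compose[OF filterlim_subseq[OF r(1)] filterlim_subseq[OF l]])
  qed
  then show ?thesis by blast
qed

definition mean :: "(nat \<Rightarrow> 'a::real_vector) \<Rightarrow> nat \<Rightarrow> 'a" where
  "mean u N = (1 / real N) *\<^sub>R (\<Sum>j<N. u j)"

lemma mean_add: "mean (\<lambda>j. u j + v j) N = mean u N + mean v N"
  by (simp add: mean_def sum.distrib scaleR_add_right)

lemma mean_minus_const: "N > 0 \<Longrightarrow> mean u N - c = (1 / real N) *\<^sub>R (\<Sum>j<N. u j - c)"
  by (simp add: mean_def sum_subtractf scaleR_diff_right sum_constant_scaleR)

lemma mean_tendsto:
  fixes u :: "nat \<Rightarrow> 'a::real_normed_vector"
  assumes "u \<longlonglongrightarrow> c"
  shows "mean u \<longlonglongrightarrow> c"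
proof (rule LIMSEQ_I)
  fix e :: real assume e: "e > 0"
  then obtain M where M: "\<And>j. j \<ge> M \<Longrightarrow> norm (u j - c) < e / 2"
    using LIMSEQ_D[OF assms, of "e / 2"] by auto
  define C where "C = (\<Sum>j<M. norm (u j - c))"
  have "norm (mean u N - c) < e" if N: "N \<ge> M" "N > 0" "real N > 2 * C / e" for N
  proof -
    have "norm (\<Sum>j<N. u j - c) \<le> (\<Sum>j<N. norm (u j - c))" by (rule norm_sum)
    also have "\<dots> = C + (\<Sum>j=M..<N. norm (u j - c))"
      unfolding C_def lessThan_atLeast0 using N by (intro sum.atLeastLessThan_concat[symmetric]) auto
    also have "(\<Sum>j=M..<N. norm (u j - c)) \<le> (\<Sum>j=M..<N. e / 2)"
      by (intro sum_mono less_imp_le[OF M]) simp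
    also have "\<dots> \<le> real N * (e / 2)" using e by (simp add: mult_right_mono)
    also have "C + real N * (e / 2) < real N * e" using N e by (simp add: field_simps)
    finally show ?thesis
      unfolding mean_minus_const[OF N(2)] using N(2) by (simp add: field_simps)
  qed
  moreover obtain N0 where "real N0 > 2 * C / e" using reals_Archimedean2 by blast
  ultimately show "\<exists>N0. \<forall>N\<ge>N0. norm (mean u N - c) < e"
    by (intro exI[of _ "max (max M 1) N0"]) auto
qed

lemma infdist_translation:
  fixes a c :: "'a::real_normed_vector"
  shows "infdist (a + c) ((\<lambda>u. u + c) ` S) = infdist a S"
  by (simp add: infdist_def image_image dist_norm)

lemma infdist_mean_add_tendsto:
  fixes u v :: "nat \<Rightarrow> 'a::real_normed_vector"
  assumes u: "(\<lambda>N. infdist (mean u N) S) \<longlonglongrightarrow> 0" and v: "v \<longlonglongrightarrow> c"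
  shows "(\<lambda>N. infdist (mean (\<lambda>j. u j + v j) N) ((\<lambda>s. s + c) ` S)) \<longlonglongrightarrow> 0"
proof (rule Lim_null_comparison[OF always_eventually[OF allI]])
  fix N
  have "infdist (mean u N + mean v N) ((\<lambda>s. s + c) ` S) \<le>
      infdist (mean u N + c) ((\<lambda>s. s + c) ` S) + dist (mean u N + mean v N) (mean u N + c)"
    by (rule infdist_triangle)
  then show "norm (infdist (mean (\<lambda>j. u j + v j) N) ((\<lambda>s. s + c) ` S)) \<le>
      infdist (mean u N) S + dist (mean v N) c"
    by (simp add: infdist_translation mean_add infdist_nonneg)
next
  have "(\<lambda>N. infdist (mean u N) S + dist (mean v N) c) \<longlonglongrightarrow> 0 + dist c c"
    by (intro tendsto_add u tendsto_dist mean_tendsto v tendsto_const)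
  then show "(\<lambda>N. infdist (mean u N) S + dist (mean v N) c) \<longlonglongrightarrow> 0" by simp
qed

lemma mean_tendsto_if_inner_partial_sum_le:
  fixes u :: "nat \<Rightarrow> 'a::real_inner"
  assumes bound: "\<And>n. norm (u n - c) \<le> B"
    and angle: "\<And>n. (u n - c) \<bullet> (\<Sum>j<n. u j - c) \<le> C"
  shows "mean u \<longlonglongrightarrow> c"
proof (rule LIM_zero_cancel, rule Lim_null_comparison)
  have square: "(norm (\<Sum>j<n. u j - c))\<^sup>2 \<le> (B\<^sup>2 + 2 * C) * real n" for n
  proof (induction n)
    case (Suc n)
    let ?s = "\<Sum>j<n. u j - c" and ?d = "u n - c"
    have "(norm ?d)\<^sup>2 \<le> B\<^sup>2" by (simp add: bound power_mono)
    moreover have "(norm (?s + ?d))\<^sup>2 = (norm ?s)\<^sup>2 + 2 * (?d \<bullet> ?s) + (norm ?d)\<^sup>2"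
      by (simp only: power2_norm_eq_inner inner_add_left inner_add_right inner_commute[of ?s ?d])
    ultimately show ?case using Suc angle[of n] by (simp add: algebra_simps)
  qed simp
  have "norm (mean u N - c) \<le> sqrt ((B\<^sup>2 + 2 * C) / real N)" if "N > 0" for N
  proof (rule real_le_rsqrt)
    have "(norm (mean u N - c))\<^sup>2 = (norm (\<Sum>j<N. u j - c))\<^sup>2 / (real N)\<^sup>2"
      unfolding mean_minus_const[OF that] by (simp add: power_divide)
    also have "\<dots> \<le> (B\<^sup>2 + 2 * C) * real N / (real N)\<^sup>2"
      by (intro divide_right_mono square) simp
    finally show "(norm (mean u N - c))\<^sup>2 \<le> (B\<^sup>2 + 2 * C) / real N"
      using that by (simp add: power2_eq_square)
  qed
  then show "\<forall>\<^sub>F N in sequentially. norm (mean u N - c) \<le> sqrt ((B\<^sup>2 + 2 * C) / real N)"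
    by (rule eventually_mono[OF eventually_gt_at_top])
  show "(\<lambda>N. sqrt ((B\<^sup>2 + 2 * C) / real N)) \<longlonglongrightarrow> 0"
    using tendsto_real_sqrt[OF lim_const_over_n[of "B\<^sup>2 + 2 * C"]] by simp
qed

lemma convergent_if_limsup_le_liminf:
  fixes a :: "nat \<Rightarrow> real"
  assumes "bounded (range a)" "limsup (\<lambda>k. ereal (a k)) \<le> liminf (\<lambda>k. ereal (a k))"
  shows "convergent a"
proof -
  define l where "l = limsup (\<lambda>k. ereal (a k))"
  have "liminf (\<lambda>k. ereal (a k)) = l"
    using Liminf_le_Limsup[of sequentially "\<lambda>k. ereal (a k)"] assms(2) by (simp add: l_def)
  then have lim: "(\<lambda>k. ereal (a k)) \<longlonglongrightarrow> l"
    by (intro Liminf_eq_Limsup) (simp_all add: l_def)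
  obtain C where "\<And>k. \<bar>a k\<bar> \<le> C" using assms(1) by (auto simp: bounded_iff)
  then have C: "- C \<le> a k" "a k \<le> C" for k using abs_le_iff[of "a k" C] by (auto simp: minus_le_iff)
  have "ereal (- C) \<le> l" by (rule tendsto_lowerbound[OF lim]) (simp_all add: C)
  moreover have "l \<le> ereal C" by (rule tendsto_upperbound[OF lim]) (simp_all add: C)
  ultimately obtain c where "l = ereal c" by (cases l) auto
  then show ?thesis using lim by (auto simp: convergent_def)
qed

lemma oscillates_if_not_convergent:
  fixes a :: "nat \<Rightarrow> real"
  assumes "bounded (range a)" "\<not> convergent a"
  obtains p q where "p < q" "\<exists>\<^sub>F k in sequentially. a k \<le> p" "\<exists>\<^sub>F k in sequentially. q \<le> a k"
proof -
  define l u where "l = liminf (\<lambda>k. ereal (a k))" and "u = limsup (\<lambda>k. ereal (a k))"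
  have "l < u" using convergent_if_limsup_le_liminf[OF assms(1)] assms(2) unfolding l_def u_def by force
  then obtain p where p: "l < ereal p" "ereal p < u" using ereal_dense2 by blast
  then obtain q where q: "ereal p < ereal q" "ereal q < u" using ereal_dense2 by blast
  have "\<not> (\<forall>\<^sub>F k in sequentially. p < a k)"
  proof
    assume "\<forall>\<^sub>F k in sequentially. p < a k"
    then have "\<forall>\<^sub>F k in sequentially. ereal p \<le> ereal (a k)" by eventually_elim simp
    then have "ereal p \<le> l" unfolding l_def by (rule Liminf_bounded)
    then show False using p(1) by simp
  qed
  moreover have "\<not> (\<forall>\<^sub>F k in sequentially. a k < q)"
  proof
    assume "\<forall>\<^sub>F k in sequentially. a k < q"
    then have "\<forall>\<^sub>F k in sequentially. ereal (a k) \<le> ereal q" by eventually_elim simp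
    then have "u \<le> ereal q" unfolding u_def by (rule Limsup_bounded)
    then show False using q(2) by simp
  qed
  ultimately show ?thesis using that[of p q] q(1) by (simp add: frequently_def not_le)
qed

lemma last_index_below:
  fixes a :: "nat \<Rightarrow> 'a::linorder"
  assumes "i \<le> l" "a i \<le> r" "r < a l"
  obtains k where "i \<le> k" "k < l" "a k \<le> r" "\<And>j. k < j \<Longrightarrow> j \<le> l \<Longrightarrow> r < a j"
proof -
  define P where "P j \<longleftrightarrow> j \<le> l \<and> a j \<le> r" for j
  define k where "k = Greatest P"
  have bound: "\<And>j. P j \<Longrightarrow> j \<le> l" and i: "P i" using assms by (auto simp: P_def)
  have k: "P k" unfolding k_def using GreatestI_nat[of P i l] i bound by blast
  have max: "j \<le> k" if "P j" for j unfolding k_def using Greatest_le_nat[of P j l] that bound by blast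
  show ?thesis
  proof (rule that[of k])
    show "i \<le> k" "a k \<le> r" using max[OF i] k by (auto simp: P_def)
    show "k < l" using k assms(3) by (cases "k = l") (auto simp: P_def)
    show "r < a j" if "k < j" "j \<le> l" for j
      using max[of j] that unfolding P_def by (meson not_le)
  qed
qed

definition upcrossing :: "(nat \<Rightarrow> 'a::linorder) \<Rightarrow> 'a \<Rightarrow> 'a \<Rightarrow> nat \<Rightarrow> nat \<Rightarrow> bool" where
  "upcrossing a r q k l \<longleftrightarrow> k < l \<and> a k \<le> r \<and> q \<le> a l \<and> (\<forall>i. k < i \<and> i \<le> l \<longrightarrow> r < a i)"

lemma upcrossing_if_oscillating:
  assumes "\<exists>\<^sub>F k in sequentially. a k \<le> p" "\<exists>\<^sub>F k in sequentially. q \<le> a k" "p \<le> r" "r < q"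
  shows "\<exists>k\<ge>N. \<exists>l. upcrossing a r q k l"
proof -
  obtain i where i: "N \<le> i" "a i \<le> p" using assms(1) unfolding frequently_sequentially by blast
  obtain l where l: "i \<le> l" "q \<le> a l" using assms(2) unfolding frequently_sequentially by blast
  have "a i \<le> r" "r < a l" using i(2) l(2) assms(3,4) by auto
  then obtain k where "i \<le> k" "k < l" "a k \<le> r" "\<And>j. k < j \<Longrightarrow> j \<le> l \<Longrightarrow> r < a j"
    using last_index_below[OF l(1)] by blast
  then show ?thesis using i(1) l(2) by (intro exI[of _ k] exI[of _ l]) (auto simp: upcrossing_def)
qed

lemma continuous_diff_tendsto_0:
  fixes h :: "'a::{real_normed_vector, heine_borel} \<Rightarrow> 'b::real_normed_vector"
  assumes h: "continuous_on UNIV h" and u: "bounded (range u)" and v: "bounded (range v)"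
    and diff: "(\<lambda>k. u k - v k) \<longlonglongrightarrow> 0"
  shows "(\<lambda>k. h (u k) - h (v k)) \<longlonglongrightarrow> 0"
proof -
  have "bounded (range u \<union> range v)" using u v by simp
  then obtain C where C: "\<And>k. norm (u k) \<le> C" "\<And>k. norm (v k) \<le> C"
    unfolding bounded_iff by blast
  have "uniformly_continuous_on (cball 0 C) h"
    by (intro compact_uniformly_continuous continuous_on_subset[OF h]) auto
  moreover have "u k \<in> cball 0 C" "v k \<in> cball 0 C" for k using C by simp_all
  moreover have "(\<lambda>k. dist (u k) (v k)) \<longlonglongrightarrow> 0"
    unfolding dist_norm using diff by (rule tendsto_norm_zero)
  ultimately have "(\<lambda>k. dist (h (u k)) (h (v k))) \<longlonglongrightarrow> 0"
    unfolding uniformly_continuous_on_sequentially by blast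
  then show ?thesis unfolding dist_norm by (rule tendsto_norm_zero_cancel)
qed

lemma exists_le_weighted_mean:
  fixes d f :: "'a \<Rightarrow> real"
  assumes "finite A" and d: "\<And>k. k \<in> A \<Longrightarrow> 0 \<le> d k" and pos: "0 < sum d A"
  obtains k where "k \<in> A" "0 < d k" "sum d A * f k \<le> (\<Sum>i\<in>A. d i * f i)"
proof -
  define P where "P = {i \<in> A. 0 < d i}"
  have "P \<noteq> {}"
  proof
    assume "P = {}"
    then have "sum d A \<le> 0" by (intro sum_nonpos) (auto simp: P_def not_less)
    then show False using pos by simp
  qed
  moreover have fin: "finite P" using \<open>finite A\<close> by (simp add: P_def)
  ultimately have k: "arg_min_on f P \<in> P" by (intro arg_min_if_finite)
  have "d i * f (arg_min_on f P) \<le> d i * f i" if "i \<in> A" for i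
  proof (cases "0 < d i")
    case True
    then have "i \<in> P" using that by (simp add: P_def)
    then show ?thesis using arg_min_least[OF fin \<open>P \<noteq> {}\<close>] True by simp
  qed (use d[OF that] in simp)
  then have "(\<Sum>i\<in>A. d i * f (arg_min_on f P)) \<le> (\<Sum>i\<in>A. d i * f i)" by (rule sum_mono)
  then have "sum d A * f (arg_min_on f P) \<le> (\<Sum>i\<in>A. d i * f i)" by (simp only: sum_distrib_right)
  with k show ?thesis using that unfolding P_def by blast
qed

section \<open>Piecewise affine interpolation of a recursion\<close>

locale step_sizes =
  fixes \<eta> :: "nat \<Rightarrow> real"
  assumes \<eta>_pos: "\<eta> k > 0"
    and \<eta>_sum: "filterlim (\<lambda>n. \<Sum>k<n. \<eta> k) at_top sequentially"
begin

definition time :: "nat \<Rightarrow> real" where "time n = (\<Sum>k<n. \<eta> k)"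

lemma time_0 [simp]: "time 0 = 0" and time_Suc: "time (Suc n) = time n + \<eta> n"
  by (auto simp: time_def)

lemma strict_mono_time: "strict_mono time"
  unfolding strict_mono_Suc_iff using \<eta>_pos by (simp add: time_Suc)

lemmas time_less_iff = strict_mono_less[OF strict_mono_time]
lemmas time_le_iff = strict_mono_less_eq[OF strict_mono_time]

lemma time_nonneg [simp]: "0 \<le> time n"
  using time_le_iff[of 0 n] by simp

lemma time_unbounded: "\<exists>n. t \<le> time n"
  using \<eta>_sum by (auto simp: time_def filterlim_at_top eventually_sequentially)

lemma index_le_if_time_add_less:
  assumes "time m + s < time (Suc k)" "0 \<le> s"
  shows "m \<le> k"
proof -
  have "time m < time (Suc k)" using assms by linarith
  then show ?thesis by (simp add: time_less_iff)
qed

lemma step_containing: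
  assumes "0 \<le> t"
  obtains k where "time k \<le> t" "t < time (Suc k)"
proof -
  obtain n where "t + 1 \<le> time n" using time_unbounded by blast
  then have "t < time n" by simp
  then obtain k where "k < n" "time k \<le> t" "\<And>j. k < j \<Longrightarrow> j \<le> n \<Longrightarrow> t < time j"
    using last_index_below[of 0 n time t] assms by (metis le0 time_0)
  then show ?thesis using that[of k] by simp
qed

definition elapsed :: "nat \<Rightarrow> real \<Rightarrow> real" where
  "elapsed k t = max 0 (min (t - time k) (\<eta> k))"

lemma elapsed_mono: "s \<le> t \<Longrightarrow> elapsed k s \<le> elapsed k t"
  by (auto simp: elapsed_def)

lemma step_meets_if_elapsed_less:
  assumes "elapsed k s < elapsed k t"
  shows "time k < t" "s < time (Suc k)"
  using assms \<eta>_pos[of k] by (auto simp: elapsed_def time_Suc max_def min_def split: if_splits)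

lemma sum_elapsed:
  assumes "0 \<le> t" "t \<le> time n"
  shows "(\<Sum>k<n. elapsed k t) = t"
proof -
  have "(\<Sum>k<n. elapsed k t) = min t (time n)"
  proof (induction n)
    case (Suc n)
    then show ?case using \<eta>_pos[of n] by (auto simp: elapsed_def time_Suc min_def max_def)
  qed (use assms in simp)
  then show ?thesis using assms by simp
qed

definition interpolate :: "'a::real_vector \<Rightarrow> (nat \<Rightarrow> 'a) \<Rightarrow> real \<Rightarrow> 'a" where
  "interpolate y u t = y - (\<Sum>k | time k < t. elapsed k t *\<^sub>R u k)"

lemma interpolate_eq:
  assumes "t \<le> time n"
  shows "interpolate y u t = y - (\<Sum>k<n. elapsed k t *\<^sub>R u k)"
proof -
  have "{k. time k < t} \<subseteq> {..<n}"
  proof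
    fix k assume "k \<in> {k. time k < t}"
    then have "time k < time n" using assms by simp
    then show "k \<in> {..<n}" by (simp add: time_less_iff)
  qed
  then have "(\<Sum>k | time k < t. elapsed k t *\<^sub>R u k) = (\<Sum>k<n. elapsed k t *\<^sub>R u k)"
    by (intro sum.mono_neutral_left) (auto simp: elapsed_def)
  then show ?thesis by (simp add: interpolate_def)
qed

lemma interpolate_time:
  assumes Y_Suc: "\<And>k. Y (Suc k) = Y k - \<eta> k *\<^sub>R u k"
  shows "interpolate (Y 0) u (time k) = Y k"
proof -
  have "elapsed i (time k) = \<eta> i" if "i < k" for i
    using that time_le_iff[of "Suc i" k] \<eta>_pos[of i] by (simp add: elapsed_def time_Suc)
  then have "interpolate (Y 0) u (time k) = Y 0 - (\<Sum>i<k. \<eta> i *\<^sub>R u i)"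
    by (simp add: interpolate_eq[of _ k])
  also have "\<dots> = Y k" by (induction k) (simp_all add: Y_Suc algebra_simps)
  finally show ?thesis .
qed

lemma interpolate_increment:
  fixes u :: "nat \<Rightarrow> 'a::real_vector"
  assumes "0 \<le> s" "s \<le> t"
  obtains n and d :: "nat \<Rightarrow> real" where "\<And>k. 0 \<le> d k" "(\<Sum>k<n. d k) = t - s"
    "\<And>k. 0 < d k \<Longrightarrow> time k < t \<and> s < time (Suc k)"
    "interpolate y u s - interpolate y u t = (\<Sum>k<n. d k *\<^sub>R u k)"
proof -
  obtain n where n: "t \<le> time n" using time_unbounded by blast
  show ?thesis
  proof (rule that[of "\<lambda>k. elapsed k t - elapsed k s" n])
    show "(\<Sum>k<n. elapsed k t - elapsed k s) = t - s"
      using n assms by (simp add: sum_subtractf sum_elapsed)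
    show "interpolate y u s - interpolate y u t = (\<Sum>k<n. (elapsed k t - elapsed k s) *\<^sub>R u k)"
      using n assms by (simp add: interpolate_eq[of _ n] sum_subtractf scaleR_diff_left)
  qed (use elapsed_mono[OF assms(2)] step_meets_if_elapsed_less in auto)
qed

lemma lipschitz_on_interpolate:
  fixes u :: "nat \<Rightarrow> 'a::real_normed_vector"
  assumes u: "\<And>k. norm (u k) \<le> R"
  shows "R-lipschitz_on {0..} (interpolate y u)"
proof (rule lipschitz_on_leI)
  fix s t :: real assume "s \<in> {0..}" "t \<in> {0..}" "s \<le> t"
  then obtain n d where d: "\<And>k. 0 \<le> d k" "(\<Sum>k<n. d k) = t - s"
    "interpolate y u s - interpolate y u t = (\<Sum>k<n. d k *\<^sub>R u k)"
    using interpolate_increment[of s t y u] by (metis atLeast_iff)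
  have "norm (\<Sum>k<n. d k *\<^sub>R u k) \<le> (\<Sum>k<n. d k * R)"
    by (rule sum_norm_le) (simp add: d(1) u mult_left_mono)
  also have "\<dots> = R * dist s t"
    using \<open>s \<le> t\<close> unfolding sum_distrib_right[symmetric] d(2) by (simp add: dist_real_def mult.commute)
  finally show "dist (interpolate y u s) (interpolate y u t) \<le> R * dist s t"
    by (simp add: dist_norm d(3))
qed (use u[of 0] norm_ge_zero order_trans in blast)

lemma interpolate_mean_value:
  fixes u :: "nat \<Rightarrow> 'a::real_inner"
  assumes "0 \<le> s" "s < t"
  obtains k where "time k < t" "s < time (Suc k)"
    "(t - s) * (u k \<bullet> w) \<le> (interpolate y u s - interpolate y u t) \<bullet> w"
proof -
  obtain n d where d: "\<And>k. 0 \<le> d k" "(\<Sum>k<n. d k) = t - s"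
    "\<And>k. 0 < d k \<Longrightarrow> time k < t \<and> s < time (Suc k)"
    "interpolate y u s - interpolate y u t = (\<Sum>k<n. d k *\<^sub>R u k)"
    using interpolate_increment[of s t y u] assms by (metis less_imp_le)
  have "0 < (\<Sum>k<n. d k)" using d(2) assms(2) by simp
  then obtain k where k: "0 < d k" "(\<Sum>k<n. d k) * (u k \<bullet> w) \<le> (\<Sum>k<n. d k * (u k \<bullet> w))"
    using exists_le_weighted_mean[of "{..<n}" d "\<lambda>k. u k \<bullet> w"] d(1) by blast
  have "(interpolate y u s - interpolate y u t) \<bullet> w = (\<Sum>k<n. d k * (u k \<bullet> w))"
    by (simp only: d(4) inner_sum_left inner_scaleR_left)
  then show ?thesis using that d(3)[OF k(1)] k(2) unfolding d(2) by metis
qed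

end

section \<open>Averaged recursions and their limit curves\<close>

text \<open>A sequence \<open>U\<close> of directions need not approach \<open>F x\<close>, only its averages along subsequences
  with \<open>X (r j) \<longlonglongrightarrow> x\<close> do. The auxiliary sequence \<open>Y\<close> leaves room for a vanishing perturbation of \<open>X\<close>.\<close>

locale averaged_recursion = step_sizes +
  fixes X Y U :: "nat \<Rightarrow> 'a::euclidean_space" and F :: "'a \<Rightarrow> 'a set" and K :: "'a set"
  assumes \<eta>_tendsto_0: "\<eta> \<longlonglongrightarrow> 0"
    and compact_K: "compact K"
    and X_in_K: "X k \<in> K"
    and compact_F: "compact (F x)"
    and F_nonempty: "F x \<noteq> {}"
    and mean_tendsto_F: "strict_mono (r :: nat \<Rightarrow> nat) \<Longrightarrow> (\<lambda>j. X (r j)) \<longlonglongrightarrow> x \<Longrightarrow>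
          (\<lambda>N. infdist (mean (\<lambda>j. U (r j)) N) (F x)) \<longlonglongrightarrow> 0"
    and Y_diff_X: "(\<lambda>k. Y k - X k) \<longlonglongrightarrow> 0"
    and Y_Suc: "Y (Suc k) = Y k - \<eta> k *\<^sub>R U k"
begin

lemma mean_along_greedy_subsequence:
  assumes "\<And>e n s. e > 0 \<Longrightarrow> \<exists>\<^sub>F k in sequentially. dist (X k) x < e \<and> Q n s (U k)"
  shows "\<exists>u. (\<forall>n. u n \<in> range U \<and> Q n (\<Sum>j<n. u j) (u n)) \<and> (\<lambda>N. infdist (mean u N) (F x)) \<longlonglongrightarrow> 0"
proof -
  have "\<exists>\<^sub>F k in sequentially. dist (X k) x < 1 / real (Suc n) \<and> Q n s (U k)" for n s
    by (rule assms) simp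
  from greedy_subsequence[of "\<lambda>n s k. dist (X k) x < 1 / real (Suc n) \<and> Q n s (U k)", OF this, of U]
  obtain r where r: "strict_mono r"
    "\<And>n. dist (X (r n)) x < 1 / real (Suc n) \<and> Q n (\<Sum>j<n. U (r j)) (U (r n))"
    by blast
  have "(\<lambda>n. X (r n) - x) \<longlonglongrightarrow> 0"
    using r(2) by (intro LIMSEQ_norm_0) (simp add: dist_norm)
  then have "(\<lambda>n. X (r n)) \<longlonglongrightarrow> x" by (rule LIM_zero_cancel)
  from mean_tendsto_F[OF r(1) this] show ?thesis
    using r(2) by (intro exI[of _ "\<lambda>n. U (r n)"]) simp
qed

text \<open>If \<open>U\<close> were unbounded, a subsequence growing fast enough would have unbounded averages.\<close>

lemma bounded_U: "bounded (range U)"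
proof (rule ccontr)
  assume "\<not> ?thesis"
  then obtain x where x: "\<And>e R. e > 0 \<Longrightarrow> \<exists>\<^sub>F k in sequentially. dist (X k) x < e \<and> R \<le> norm (U k)"
    using unbounded_near_cluster_point[OF compact_K, of X U] X_in_K by auto
  obtain u where u: "\<And>n. (real (Suc n))\<^sup>2 + norm (\<Sum>j<n. u j) \<le> norm (u n)"
    and lim: "(\<lambda>N. infdist (mean u N) (F x)) \<longlonglongrightarrow> 0"
    using mean_along_greedy_subsequence[of x "\<lambda>n s v. (real (Suc n))\<^sup>2 + norm s \<le> norm v", OF x]
    by metis
  obtain C where C: "\<And>v. v \<in> F x \<Longrightarrow> norm v \<le> C"
    using compact_imp_bounded[OF compact_F, of x] unfolding bounded_iff by blast
  have index_le: "real (Suc n) \<le> infdist (mean u (Suc n)) (F x) + C" for n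
  proof -
    have "(real (Suc n))\<^sup>2 \<le> norm (u n) - norm (\<Sum>j<n. u j)" using u[of n] by linarith
    also have "\<dots> \<le> norm (\<Sum>j<Suc n. u j)"
      using norm_diff_ineq[of "u n" "\<Sum>j<n. u j"] by (simp add: add.commute)
    finally have "real (Suc n) \<le> norm (\<Sum>j<Suc n. u j) / real (Suc n)"
      by (simp only: pos_le_divide_eq of_nat_0_less_iff zero_less_Suc power2_eq_square)
    also have "\<dots> = norm (mean u (Suc n))" by (simp add: mean_def)
    finally have "real (Suc n) \<le> norm (mean u (Suc n))" .
    moreover obtain v where "v \<in> F x" "infdist (mean u (Suc n)) (F x) = dist (mean u (Suc n)) v"
      using infdist_attains_inf[OF compact_imp_closed[OF compact_F] F_nonempty] by metis
    ultimately show ?thesis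
      using C[of v] norm_triangle_ineq2[of "mean u (Suc n)" v] by (simp add: dist_norm)
  qed
  have "\<forall>\<^sub>F n in sequentially. infdist (mean u (Suc n)) (F x) < 1"
    using order_tendstoD(2)[OF LIMSEQ_Suc[OF lim], of 1] by simp
  moreover have "\<forall>\<^sub>F n in sequentially. C + 1 \<le> real n"
    using filterlim_real_sequentially by (simp add: filterlim_at_top)
  ultimately have "\<forall>\<^sub>F n::nat in sequentially. False"
  proof eventually_elim
    case (elim n)
    then show ?case using index_le[of n] by linarith
  qed
  then show False by simp
qed

text \<open>The set \<open>F x\<close> need not be convex. Choosing each new direction at an almost obtuse angle to the
  sum of the previous ones, all taken relative to \<open>g\<close>, keeps these sums of size \<open>O(\<surd>N)\<close>, so \<open>g\<close>
  is a limit of averages.\<close>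

lemma mem_F_if_frequently_halfspace:
  assumes "\<And>w e. e > 0 \<Longrightarrow> \<exists>\<^sub>F k in sequentially. dist (X k) x < e \<and> (U k - g) \<bullet> w \<le> e"
  shows "g \<in> F x"
proof -
  have obtuse: "\<exists>\<^sub>F k in sequentially. dist (X k) x < e \<and> (U k - g) \<bullet> (s - real n *\<^sub>R g) \<le> 1"
    if "e > 0" for e n s
    using assms[of "min e 1" "s - real n *\<^sub>R g"] that by (auto elim!: frequently_elim1)
  obtain u where u: "\<And>n. u n \<in> range U" "\<And>n. (u n - g) \<bullet> ((\<Sum>j<n. u j) - real n *\<^sub>R g) \<le> 1"
    and lim: "(\<lambda>N. infdist (mean u N) (F x)) \<longlonglongrightarrow> 0"
    using mean_along_greedy_subsequence[of x "\<lambda>n s v. (v - g) \<bullet> (s - real n *\<^sub>R g) \<le> 1", OF obtuse]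
    by blast
  obtain R where R: "\<And>k. norm (U k) \<le> R" using bounded_U by (auto simp: bounded_iff)
  have "mean u \<longlonglongrightarrow> g"
  proof (rule mean_tendsto_if_inner_partial_sum_le)
    show "norm (u n - g) \<le> R + norm g" for n
      using u(1)[of n] R norm_triangle_ineq4[of "u n" g] by (force intro: order_trans add_right_mono)
    show "(u n - g) \<bullet> (\<Sum>j<n. u j - g) \<le> 1" for n
      using u(2)[of n] by (simp add: sum_subtractf sum_constant_scaleR)
  qed
  then have "(\<lambda>N. infdist (mean u N) (F x)) \<longlonglongrightarrow> infdist g (F x)"
    by (rule tendsto_infdist)
  then have "infdist g (F x) = 0" using lim by (rule LIMSEQ_unique)
  then show ?thesis
    using in_closed_iff_infdist_zero[OF compact_imp_closed[OF compact_F] F_nonempty] by simp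
qed

definition speed_bound :: real where "speed_bound = (SUP k. norm (U k))"

lemma norm_U_le: "norm (U k) \<le> speed_bound"
  unfolding speed_bound_def using bounded_U
  by (intro cSUP_upper) (auto intro!: bounded_imp_bdd_above simp: bounded_norm_comp)

lemma speed_bound_nonneg: "0 \<le> speed_bound"
  using norm_U_le[of 0] norm_ge_zero order_trans by blast

definition trajectory :: "real \<Rightarrow> 'a" where "trajectory = interpolate (Y 0) U"

lemma trajectory_time [simp]: "trajectory (time k) = Y k"
  unfolding trajectory_def by (rule interpolate_time[OF Y_Suc])

lemma dist_trajectory_le:
  "0 \<le> s \<Longrightarrow> 0 \<le> t \<Longrightarrow> dist (trajectory s) (trajectory t) \<le> speed_bound * \<bar>s - t\<bar>"
  using lipschitz_onD[OF lipschitz_on_interpolate[OF norm_U_le], of s t "Y 0"]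
  by (simp add: trajectory_def dist_real_def)

lemma bounded_X: "bounded (range X)"
  using bounded_subset[OF compact_imp_bounded[OF compact_K]] X_in_K by blast

lemma bounded_Y: "bounded (range Y)"
proof -
  have "bounded (range (\<lambda>k. X k + (Y k - X k)))"
    by (intro bounded_plus_comp bounded_X convergent_imp_bounded[OF Y_diff_X])
  then show ?thesis by simp
qed

definition limit_curve :: "(nat \<Rightarrow> nat) \<Rightarrow> real \<Rightarrow> (real \<Rightarrow> 'a) \<Rightarrow> bool" where
  "limit_curve m T x \<longleftrightarrow> filterlim m at_top sequentially \<and>
     uniform_limit {0..T} (\<lambda>j s. trajectory (time (m j) + s)) x sequentially"

lemma limit_curve_exists:
  assumes m: "filterlim m at_top sequentially"
  obtains l x where "strict_mono l" "limit_curve (m \<circ> l) T x"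
proof -
  define y where "y j s = trajectory (time (m j) + s)" for j s
  have y_dist: "dist (y j s) (y j t) \<le> speed_bound * \<bar>s - t\<bar>" if "0 \<le> s" "0 \<le> t" for j s t
    unfolding y_def using dist_trajectory_le[of "time (m j) + s" "time (m j) + t"] that by simp
  obtain C where C: "\<And>k. norm (Y k) \<le> C" using bounded_Y by (auto simp: bounded_iff)
  have "norm (y j s) \<le> C + speed_bound * T" if "s \<in> {0..T}" for j s
  proof -
    have "norm (y j s) \<le> norm (y j 0) + dist (y j s) (y j 0)"
      using norm_triangle_sub by (simp add: dist_norm)
    also have "dist (y j s) (y j 0) \<le> speed_bound * T"
      using y_dist[of s 0 j] that speed_bound_nonneg by (auto intro: order_trans mult_left_mono)
    also have "norm (y j 0) \<le> C" using C by (simp add: y_def)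
    finally show ?thesis by simp
  qed
  moreover have "\<exists>d>0. \<forall>j t. t \<in> {0..T} \<and> norm (s - t) < d \<longrightarrow> norm (y j s - y j t) < e"
    if "s \<in> {0..T}" "e > 0" for s e
  proof (intro exI[of _ "e / (speed_bound + 1)"] conjI allI impI)
    show "e / (speed_bound + 1) > 0" using that speed_bound_nonneg by simp
    fix j t assume t: "t \<in> {0..T} \<and> norm (s - t) < e / (speed_bound + 1)"
    have "norm (y j s - y j t) \<le> speed_bound * \<bar>s - t\<bar>"
      using y_dist[of s t j] that t by (simp add: dist_norm)
    also have "\<dots> \<le> (speed_bound + 1) * \<bar>s - t\<bar>" by (simp add: mult_right_mono)
    also have "\<dots> < e" using t speed_bound_nonneg by (simp add: field_simps)
    finally show "norm (y j s - y j t) < e" .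
  qed
  ultimately obtain x l where l: "strict_mono (l :: nat \<Rightarrow> nat)"
    and conv: "\<And>e. 0 < e \<Longrightarrow> \<exists>N. \<forall>n s. n \<ge> N \<and> s \<in> {0..T} \<longrightarrow> norm (y (l n) s - x s) < e"
    by (rule Arzela_Ascoli[OF compact_Icc]) auto
  have "uniform_limit {0..T} (\<lambda>j. y (l j)) x sequentially"
    unfolding uniform_limit_sequentially_iff dist_norm using conv by blast
  then have "limit_curve (m \<circ> l) T x"
    using filterlim_compose[OF m filterlim_subseq[OF l]]
    by (simp add: limit_curve_def y_def[abs_def] o_def)
  then show ?thesis using that l by blast
qed

lemma limit_curve_tendsto:
  "limit_curve m T x \<Longrightarrow> s \<in> {0..T} \<Longrightarrow> (\<lambda>j. trajectory (time (m j) + s)) \<longlonglongrightarrow> x s"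
  unfolding limit_curve_def by (elim conjE) (rule tendsto_uniform_limitI)

lemma limit_curve_start: "limit_curve m T x \<Longrightarrow> 0 \<le> T \<Longrightarrow> (\<lambda>j. Y (m j)) \<longlonglongrightarrow> x 0"
  using limit_curve_tendsto[of m T x 0] by simp

lemma lipschitz_on_limit_curve:
  assumes x: "limit_curve m T x"
  shows "speed_bound-lipschitz_on {0..T} x"
proof (rule lipschitz_onI)
  fix s t assume s_t: "s \<in> {0..T}" "t \<in> {0..T}"
  have "(\<lambda>j. dist (trajectory (time (m j) + s)) (trajectory (time (m j) + t))) \<longlonglongrightarrow> dist (x s) (x t)"
    by (intro tendsto_dist limit_curve_tendsto[OF x] s_t)
  moreover have "dist (trajectory (time (m j) + s)) (trajectory (time (m j) + t)) \<le>
      speed_bound * dist s t" for j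
    using dist_trajectory_le[of "time (m j) + s" "time (m j) + t"] s_t by (simp add: dist_real_def)
  ultimately show "dist (x s) (x t) \<le> speed_bound * dist s t" by (blast intro: LIMSEQ_le_const2)
qed (rule speed_bound_nonneg)

lemma limit_curve_iterates:
  assumes x: "limit_curve m T x" and s: "s \<in> {0..T}"
  obtains k where "\<And>j. m j \<le> k j" "\<And>j. time (k j) \<le> time (m j) + s" "(\<lambda>j. Y (k j)) \<longlonglongrightarrow> x s"
proof -
  have "\<exists>k. time k \<le> time (m j) + s \<and> time (m j) + s < time (Suc k)" for j
    using step_containing[of "time (m j) + s"] s
    by (metis add_nonneg_nonneg atLeastAtMost_iff time_nonneg)
  then obtain k where k: "\<And>j. time (k j) \<le> time (m j) + s" "\<And>j. time (m j) + s < time (Suc (k j))"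
    by metis
  have m_le: "m j \<le> k j" for j using k(2) s by (intro index_le_if_time_add_less[of _ s]) auto
  have m: "filterlim m at_top sequentially" using x by (simp add: limit_curve_def)
  have "(\<lambda>j. Y (k j) - trajectory (time (m j) + s)) \<longlonglongrightarrow> 0"
  proof (rule Lim_null_comparison[OF always_eventually[OF allI]])
    show "norm (Y (k j) - trajectory (time (m j) + s)) \<le> speed_bound * \<eta> (k j)" for j
    proof -
      have "dist (trajectory (time (k j))) (trajectory (time (m j) + s)) \<le>
          speed_bound * \<bar>time (k j) - (time (m j) + s)\<bar>"
        using s by (intro dist_trajectory_le) auto
      also have "\<dots> \<le> speed_bound * \<eta> (k j)"
        using k[of j] by (intro mult_left_mono speed_bound_nonneg) (simp add: time_Suc)
      finally show ?thesis by (simp add: dist_norm)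
    qed
    have "filterlim k at_top sequentially" by (rule filterlim_at_top_mono[OF m]) (simp add: m_le)
    then show "(\<lambda>j. speed_bound * \<eta> (k j)) \<longlonglongrightarrow> 0"
      by (intro tendsto_mult_right_zero filterlim_compose[OF \<eta>_tendsto_0])
  qed
  from tendsto_add[OF this limit_curve_tendsto[OF x s]] have "(\<lambda>j. Y (k j)) \<longlonglongrightarrow> x s" by simp
  then show ?thesis using that m_le k(1) by blast
qed

lemma dist_iterate_trajectory_le:
  assumes "0 \<le> a" "0 < s" "time k < a + s" "a < time (Suc k)"
  shows "dist (X k) (trajectory a) \<le> speed_bound * s + (speed_bound * \<eta> k + norm (Y k - X k))"
proof -
  have "dist (Y k) (trajectory a) \<le> speed_bound * \<bar>time k - a\<bar>"
    using dist_trajectory_le[of "time k" a] assms(1) by simp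
  also have "\<dots> \<le> speed_bound * (s + \<eta> k)"
    using assms \<eta>_pos[of k] by (intro mult_left_mono speed_bound_nonneg) (auto simp: time_Suc abs_le_iff)
  finally show ?thesis
    using dist_triangle[of "X k" "trajectory a" "Y k"]
    by (simp add: dist_norm norm_minus_commute algebra_simps)
qed

lemma limit_curve_mean_value:
  assumes x: "limit_curve m T x" and t: "0 \<le> t" "0 < s" "t + s \<le> T" and \<epsilon>: "\<epsilon> > 0"
  shows "\<exists>\<^sub>F k in sequentially.
     dist (X k) (x t) < speed_bound * s + \<epsilon> \<and> s * (U k \<bullet> w) < (x t - x (t + s)) \<bullet> w + \<epsilon>"
proof -
  define a where "a j = time (m j) + t" for j
  have a: "0 \<le> a j" for j using t by (simp add: a_def)
  have "\<exists>k. time k < a j + s \<and> a j < time (Suc k) \<and>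
      s * (U k \<bullet> w) \<le> (trajectory (a j) - trajectory (a j + s)) \<bullet> w" for j
    using interpolate_mean_value[OF a, of j "a j + s" U w "Y 0"] t(2)
    by (metis add_diff_cancel_left' less_add_same_cancel1 trajectory_def)
  then obtain k where k: "\<And>j. time (k j) < a j + s" "\<And>j. a j < time (Suc (k j))"
    "\<And>j. s * (U (k j) \<bullet> w) \<le> (trajectory (a j) - trajectory (a j + s)) \<bullet> w"
    by metis
  have "m j \<le> k j" for j using k(2) t(1) by (intro index_le_if_time_add_less[of _ t]) (auto simp: a_def)
  moreover have "filterlim m at_top sequentially" using x by (simp add: limit_curve_def)
  ultimately have k_lim: "filterlim k at_top sequentially" by (auto intro: filterlim_at_top_mono)
  have x_t: "(\<lambda>j. trajectory (a j)) \<longlonglongrightarrow> x t" and x_ts: "(\<lambda>j. trajectory (a j + s)) \<longlonglongrightarrow> x (t + s)"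
    unfolding a_def add.assoc using t by (auto intro!: limit_curve_tendsto[OF x])
  have "(\<lambda>j. speed_bound * \<eta> (k j) + norm (Y (k j) - X (k j)) + dist (trajectory (a j)) (x t))
      \<longlonglongrightarrow> speed_bound * 0 + norm (0::'a) + dist (x t) (x t)"
    by (intro tendsto_intros x_t filterlim_compose[OF _ k_lim] \<eta>_tendsto_0 Y_diff_X)
  then have "\<forall>\<^sub>F j in sequentially.
      speed_bound * \<eta> (k j) + norm (Y (k j) - X (k j)) + dist (trajectory (a j)) (x t) < \<epsilon>"
    using \<epsilon> by (intro order_tendstoD(2)) auto
  moreover have "\<forall>\<^sub>F j in sequentially.
      (trajectory (a j) - trajectory (a j + s)) \<bullet> w < (x t - x (t + s)) \<bullet> w + \<epsilon>"
    using order_tendstoD(2)[OF tendsto_inner[OF tendsto_diff[OF x_t x_ts] tendsto_const]] \<epsilon> by simp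
  ultimately show ?thesis
  proof (intro frequently_if_eventually_subseq[OF _ k_lim], eventually_elim)
    case (elim j)
    then show ?case
      using dist_iterate_trajectory_le[OF a t(2) k(1,2)[of j]] k(3)[of j]
        dist_triangle[of "X (k j)" "x t" "trajectory (a j)"]
      by linarith
  qed
qed

lemma limit_curve_inclusion:
  assumes x: "limit_curve m T x" and t: "0 < t" "t < T"
    and deriv: "(x has_vector_derivative v) (at t)"
  shows "- v \<in> F (x t)"
proof (rule mem_F_if_frequently_halfspace)
  fix w :: 'a and e :: real
  assume e: "e > 0"
  have "((\<lambda>s. x s \<bullet> w) has_real_derivative v \<bullet> w) (at t)"
    using bounded_linear.has_vector_derivative[OF bounded_linear_inner_left deriv]
    by (simp add: has_real_derivative_iff_has_vector_derivative)
  then have "((\<lambda>s. (x (t + s) \<bullet> w - x t \<bullet> w) / s) \<longlongrightarrow> v \<bullet> w) (at_right 0)"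
    unfolding DERIV_def by (rule tendsto_within_subset) simp
  then have "\<forall>\<^sub>F s in at_right 0. v \<bullet> w - e / 2 < (x (t + s) \<bullet> w - x t \<bullet> w) / s"
    using e by (intro order_tendstoD(1)) auto
  moreover have "((\<lambda>s. speed_bound * s + s * (e / 2)) \<longlongrightarrow> speed_bound * 0 + 0 * (e / 2)) (at_right 0)"
    by (intro tendsto_intros)
  then have "\<forall>\<^sub>F s in at_right 0. speed_bound * s + s * (e / 2) < e"
    using e by (intro order_tendstoD(2)) auto
  moreover have "\<forall>\<^sub>F s in at_right 0. s \<in> {0<..<T - t}"
    using t by (intro eventually_at_right_real) simp
  ultimately have "\<forall>\<^sub>F s in at_right 0. v \<bullet> w - e / 2 < (x (t + s) \<bullet> w - x t \<bullet> w) / s \<and>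
      speed_bound * s + s * (e / 2) < e \<and> s \<in> {0<..<T - t}"
    by eventually_elim simp
  then obtain s where s: "v \<bullet> w - e / 2 < (x (t + s) \<bullet> w - x t \<bullet> w) / s"
    "speed_bound * s + s * (e / 2) < e" "0 < s" "s < T - t"
    using eventually_happens'[OF trivial_limit_at_right_real]
    by (metis (no_types, lifting) greaterThanLessThan_iff)
  have slope: "(x t - x (t + s)) \<bullet> w < s * (e / 2 - v \<bullet> w)"
    using s(1,3) by (simp add: field_simps inner_diff_left)
  have "\<exists>\<^sub>F k in sequentially. dist (X k) (x t) < speed_bound * s + s * (e / 2) \<and>
      s * (U k \<bullet> w) < (x t - x (t + s)) \<bullet> w + s * (e / 2)"
    using t e s by (intro limit_curve_mean_value[OF x]) auto
  then show "\<exists>\<^sub>F k in sequentially. dist (X k) (x t) < e \<and> (U k - - v) \<bullet> w \<le> e"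
  proof (rule frequently_elim1, elim conjE, intro conjI)
    fix k assume "dist (X k) (x t) < speed_bound * s + s * (e / 2)"
    then show "dist (X k) (x t) < e" using s(2) by simp
    assume "s * (U k \<bullet> w) < (x t - x (t + s)) \<bullet> w + s * (e / 2)"
    then have "s * (U k \<bullet> w) < s * (e - v \<bullet> w)" using slope by (simp add: algebra_simps)
    then show "(U k - - v) \<bullet> w \<le> e" using s(3) by (simp add: inner_add_left)
  qed
qed

end

section \<open>Recursions with a Lyapunov function\<close>

text \<open>By Rademacher's theorem, the following is the inclusion \<open>- \<gamma>' \<in> F(\<gamma>)\<close> almost everywhere.\<close>

definition descent_curve :: "('a \<Rightarrow> 'a set) \<Rightarrow> real \<Rightarrow> (real \<Rightarrow> 'a::real_normed_vector) \<Rightarrow> bool" where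
  "descent_curve F T \<gamma> \<longleftrightarrow> (\<exists>L. L-lipschitz_on {0..T} \<gamma>) \<and>
     (\<forall>t\<in>{0<..<T}. \<forall>v. (\<gamma> has_vector_derivative v) (at t) \<longrightarrow> - v \<in> F (\<gamma> t))"

definition lyapunov_function :: "('a::real_normed_vector \<Rightarrow> 'a set) \<Rightarrow> ('a \<Rightarrow> real) \<Rightarrow> bool" where
  "lyapunov_function F h \<longleftrightarrow> (\<forall>\<gamma> T. 0 < T \<longrightarrow> descent_curve F T \<gamma> \<longrightarrow>
     (norm (\<gamma> T - \<gamma> 0))\<^sup>2 / T \<le> h (\<gamma> 0) - h (\<gamma> T))"

lemma stationary_start_if_no_descent:
  assumes h: "lyapunov_function F h" and \<gamma>: "descent_curve F T \<gamma>" and T: "0 < T"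
    and above: "\<And>s. s \<in> {0..T} \<Longrightarrow> h (\<gamma> 0) \<le> h (\<gamma> s)"
  shows "0 \<in> F (\<gamma> 0)"
proof -
  have const: "\<gamma> s = \<gamma> 0" if s: "s \<in> {0<..<T}" for s
  proof -
    have "descent_curve F s \<gamma>"
      using \<gamma> s lipschitz_on_subset[of _ "{0..T}" \<gamma> "{0..s}"] unfolding descent_curve_def by fastforce
    then have "(norm (\<gamma> s - \<gamma> 0))\<^sup>2 / s \<le> h (\<gamma> 0) - h (\<gamma> s)"
      using h s unfolding lyapunov_function_def by simp
    also have "\<dots> \<le> 0" using above[of s] s by simp
    finally show ?thesis using s by (simp add: divide_le_0_iff)
  qed
  have "(\<gamma> has_vector_derivative 0) (at (T / 2))"
    by (rule has_vector_derivative_transform_within_open[where S = "{0<..<T}" and f = "\<lambda>_. \<gamma> 0"])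
       (use T const in auto)
  then show ?thesis using \<gamma> T const[of "T / 2"] unfolding descent_curve_def by force
qed

locale lyapunov_recursion = averaged_recursion +
  fixes h :: "'a \<Rightarrow> real"
  assumes h_cont: "continuous_on UNIV h"
    and lyapunov: "lyapunov_function F h"
    and sard: "interior (h ` {x \<in> K. 0 \<in> F x}) = {}"
begin

lemma h_tendsto: "u \<longlonglongrightarrow> z \<Longrightarrow> (\<lambda>j. h (u j)) \<longlonglongrightarrow> h z" for u :: "nat \<Rightarrow> 'a"
  using continuous_on_tendsto_compose[OF h_cont] by simp

lemma descent_curve_if_limit_curve: "limit_curve m T x \<Longrightarrow> descent_curve F T x"
  unfolding descent_curve_def using lipschitz_on_limit_curve limit_curve_inclusion by fastforce

lemma stationary_limit_if_no_descent:
  assumes m: "filterlim m at_top sequentially" and start: "(\<lambda>j. Y (m j)) \<longlonglongrightarrow> x\<^sub>0" and T: "0 < T"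
    and above: "\<And>e. e > 0 \<Longrightarrow>
      \<forall>\<^sub>F j in sequentially. \<forall>k\<ge>m j. time k \<le> time (m j) + T \<longrightarrow> h x\<^sub>0 - e \<le> h (Y k)"
  shows "0 \<in> F x\<^sub>0"
proof -
  obtain l x where l: "strict_mono l" and x: "limit_curve (m \<circ> l) T x"
    using limit_curve_exists[OF m] by blast
  have x_0: "x 0 = x\<^sub>0"
    using limit_curve_start[OF x] LIMSEQ_subseq_LIMSEQ[OF start l] T LIMSEQ_unique
    by (fastforce simp: o_def)
  have "h x\<^sub>0 \<le> h (x s)" if s: "s \<in> {0..T}" for s
  proof (rule field_le_epsilon)
    fix e :: real assume e: "e > 0"
    obtain k where k: "\<And>j. (m \<circ> l) j \<le> k j" "\<And>j. time (k j) \<le> time ((m \<circ> l) j) + s"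
      "(\<lambda>j. Y (k j)) \<longlonglongrightarrow> x s"
      using limit_curve_iterates[OF x s] by blast
    have "\<forall>\<^sub>F j in sequentially. \<forall>k\<ge>m (l j). time k \<le> time (m (l j)) + T \<longrightarrow> h x\<^sub>0 - e \<le> h (Y k)"
      by (rule eventually_compose_filterlim[OF above[OF e] filterlim_subseq[OF l]])
    then have "\<forall>\<^sub>F j in sequentially. h x\<^sub>0 - e \<le> h (Y (k j))"
    proof eventually_elim
      case (elim j)
      then show ?case using k(1,2)[of j] s by simp
    qed
    then have "h x\<^sub>0 - e \<le> h (x s)" by (rule tendsto_lowerbound[OF h_tendsto[OF k(3)]]) simp
    then show "h x\<^sub>0 \<le> h (x s) + e" by simp
  qed
  then show ?thesis
    using stationary_start_if_no_descent[OF lyapunov descent_curve_if_limit_curve[OF x] T] x_0 by simp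
qed

lemma Y_tendsto_iff_X_tendsto:
  assumes "filterlim m at_top sequentially"
  shows "(\<lambda>j. Y (m j)) \<longlonglongrightarrow> x \<longleftrightarrow> (\<lambda>j. X (m j)) \<longlonglongrightarrow> x"
  using filterlim_compose[OF Y_diff_X assms] by (rule Lim_transform_eq)

lemma dist_Y_le: "k \<le> l \<Longrightarrow> dist (Y k) (Y l) \<le> speed_bound * (time l - time k)"
  using dist_trajectory_le[of "time k" "time l"] by (simp add: time_le_iff)

lemma h_Y_Suc_diff_tendsto_0: "(\<lambda>k. h (Y (Suc k)) - h (Y k)) \<longlonglongrightarrow> 0"
proof (rule continuous_diff_tendsto_0[OF h_cont _ bounded_Y])
  show "bounded (range (\<lambda>k. Y (Suc k)))" using bounded_Y by (rule bounded_subset) auto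
  show "(\<lambda>k. Y (Suc k) - Y k) \<longlonglongrightarrow> 0"
  proof (rule Lim_null_comparison[OF always_eventually[OF allI]])
    show "norm (Y (Suc k) - Y k) \<le> speed_bound * \<eta> k" for k
      using dist_Y_le[of k "Suc k"] by (simp add: dist_norm norm_minus_commute time_Suc)
    show "(\<lambda>k. speed_bound * \<eta> k) \<longlonglongrightarrow> 0" by (intro tendsto_mult_right_zero \<eta>_tendsto_0)
  qed
qed

lemma upcrossing_duration:
  assumes "r < q"
  obtains T where "0 < T" "\<And>k l. k \<le> l \<Longrightarrow> h (Y k) \<le> r \<Longrightarrow> q \<le> h (Y l) \<Longrightarrow> time k + T < time l"
proof -
  obtain C where C: "\<And>k. Y k \<in> cball 0 C" using bounded_Y by (auto simp: bounded_iff)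
  have "uniformly_continuous_on (cball 0 C) h"
    by (intro compact_uniformly_continuous continuous_on_subset[OF h_cont]) auto
  then obtain d where d: "d > 0" "\<And>k l. dist (Y k) (Y l) < d \<Longrightarrow> dist (h (Y k)) (h (Y l)) < q - r"
    using assms C unfolding uniformly_continuous_on_def by (metis diff_gt_0_iff_gt)
  define T where "T = d / (speed_bound + 1)"
  have T: "0 < T" "speed_bound * T < d"
    using d(1) speed_bound_nonneg by (auto simp: T_def field_simps)
  have "time k + T < time l" if "k \<le> l" "h (Y k) \<le> r" "q \<le> h (Y l)" for k l
  proof (rule ccontr)
    assume "\<not> ?thesis"
    then have "speed_bound * (time l - time k) \<le> speed_bound * T"
      using speed_bound_nonneg by (intro mult_left_mono) auto
    then have "dist (Y k) (Y l) < d" using dist_Y_le[OF that(1)] T(2) by linarith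
    then show False using d(2)[of k l] that(2,3) by (simp add: dist_real_def)
  qed
  then show ?thesis using that T(1) by blast
qed

lemma noncritical_value_between:
  assumes "p < q"
  obtains r where "p < r" "r < q" "r \<notin> h ` {x \<in> K. 0 \<in> F x}"
proof -
  have "\<not> {p<..<q} \<subseteq> h ` {x \<in> K. 0 \<in> F x}"
    using interior_maximal[of "{p<..<q}" "h ` {x \<in> K. 0 \<in> F x}"] sard assms by auto
  then show ?thesis using that unfolding subset_iff greaterThanLessThan_iff by blast
qed

text \<open>An upcrossing takes at least a fixed time, so a limit curve of the upcrossings of the level \<open>r\<close>
  starts at this level and does not descend.\<close>

lemma upcrossing_limit_stationary:
  assumes m: "filterlim m at_top sequentially" and x\<^sub>0: "(\<lambda>j. Y (m j)) \<longlonglongrightarrow> x\<^sub>0"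
    and cross: "\<And>j. upcrossing (\<lambda>k. h (Y k)) r q (m j) (l j)" and "r < q"
  shows "h x\<^sub>0 = r" "0 \<in> F x\<^sub>0"
proof -
  have l: "m j < l j" and h_m: "h (Y (m j)) \<le> r" and h_l: "q \<le> h (Y (l j))"
    and above: "\<And>i. m j < i \<Longrightarrow> i \<le> l j \<Longrightarrow> r < h (Y i)" for j
    using cross[of j] by (auto simp: upcrossing_def)
  show h_x\<^sub>0: "h x\<^sub>0 = r"
  proof (rule antisym)
    show "h x\<^sub>0 \<le> r" by (rule LIMSEQ_le_const2[OF h_tendsto[OF x\<^sub>0]]) (simp add: h_m)
    from tendsto_add[OF filterlim_compose[OF h_Y_Suc_diff_tendsto_0 m] h_tendsto[OF x\<^sub>0]]
    have "(\<lambda>j. h (Y (Suc (m j)))) \<longlonglongrightarrow> h x\<^sub>0" by simp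
    moreover have "r < h (Y (Suc (m j)))" for j using above[of j "Suc (m j)"] l[of j] by simp
    ultimately show "r \<le> h x\<^sub>0" by (blast intro: LIMSEQ_le_const less_imp_le)
  qed
  obtain T where T: "0 < T" "\<And>k l. k \<le> l \<Longrightarrow> h (Y k) \<le> r \<Longrightarrow> q \<le> h (Y l) \<Longrightarrow> time k + T < time l"
    using upcrossing_duration[OF \<open>r < q\<close>] by blast
  show "0 \<in> F x\<^sub>0"
  proof (rule stationary_limit_if_no_descent[OF m x\<^sub>0 T(1)])
    fix e :: real assume "e > 0"
    then have "\<forall>\<^sub>F j in sequentially. h x\<^sub>0 - e < h (Y (m j))"
      by (intro order_tendstoD(1)[OF h_tendsto[OF x\<^sub>0]]) simp
    then show "\<forall>\<^sub>F j in sequentially. \<forall>i\<ge>m j. time i \<le> time (m j) + T \<longrightarrow> h x\<^sub>0 - e \<le> h (Y i)"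
    proof (eventually_elim, intro allI impI)
      fix j i assume start: "h x\<^sub>0 - e < h (Y (m j))" and i: "m j \<le> i" "time i \<le> time (m j) + T"
      have "time (m j) + T < time (l j)" by (intro T(2) h_m h_l less_imp_le[OF l])
      then have "i < l j" using i(2) time_less_iff by (meson order_le_less_trans)
      then have "i = m j \<or> r < h (Y i)" using above[of j i] i(1) by fastforce
      then show "h x\<^sub>0 - e \<le> h (Y i)" using start h_x\<^sub>0 \<open>e > 0\<close> by auto
    qed
  qed
qed

lemma limit_in_K:
  assumes "(\<lambda>j. X (m j)) \<longlonglongrightarrow> x"
  shows "x \<in> K"
  using closed_sequentially[OF compact_imp_closed[OF compact_K], of "\<lambda>j. X (m j)"] X_in_K assms by blast

lemma convergent_h_Y: "convergent (\<lambda>k. h (Y k))"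
proof (rule ccontr)
  assume nonconv: "\<not> ?thesis"
  obtain C where C: "\<And>k. Y k \<in> cball 0 C" using bounded_Y by (auto simp: bounded_iff)
  have "bounded (h ` cball 0 C)"
    by (intro compact_imp_bounded compact_continuous_image continuous_on_subset[OF h_cont]) auto
  then have "bounded (range (\<lambda>k. h (Y k)))" by (rule bounded_subset) (use C in blast)
  then obtain p q where pq: "p < q"
    "\<exists>\<^sub>F k in sequentially. h (Y k) \<le> p" "\<exists>\<^sub>F k in sequentially. q \<le> h (Y k)"
    using oscillates_if_not_convergent nonconv by blast
  obtain r where r: "p < r" "r < q" "r \<notin> h ` {x \<in> K. 0 \<in> F x}"
    using noncritical_value_between[OF pq(1)] by blast
  obtain k l where k: "\<And>N. N \<le> k N" "\<And>N. upcrossing (\<lambda>k. h (Y k)) r q (k N) (l N)"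
    using upcrossing_if_oscillating[OF pq(2,3) less_imp_le[OF r(1)] r(2)] by metis
  obtain x\<^sub>0 s where s: "strict_mono (s :: nat \<Rightarrow> nat)" and x\<^sub>0: "(\<lambda>j. Y (k (s j))) \<longlonglongrightarrow> x\<^sub>0"
    using bounded_imp_convergent_subsequence[of "\<lambda>N. Y (k N)", OF bounded_subset[OF bounded_Y]]
    by (auto simp: o_def)
  have m: "filterlim (\<lambda>j. k (s j)) at_top sequentially"
    by (rule filterlim_at_top_mono[OF filterlim_subseq[OF s]]) (simp add: k(1))
  note upcrossing_limit_stationary[OF m x\<^sub>0 k(2) r(2)]
  moreover have "x\<^sub>0 \<in> K" by (rule limit_in_K[OF Y_tendsto_iff_X_tendsto[OF m, THEN iffD1, OF x\<^sub>0]])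
  ultimately show False using r(3) by blast
qed

theorem convergent_h_X: "convergent (\<lambda>k. h (X k))"
proof -
  obtain c where "(\<lambda>k. h (Y k)) \<longlonglongrightarrow> c" using convergent_h_Y by (auto simp: convergent_def)
  from tendsto_diff[OF this continuous_diff_tendsto_0[OF h_cont bounded_Y bounded_X Y_diff_X]]
  show ?thesis by (auto simp: convergent_def)
qed

theorem cluster_point_stationary:
  assumes r: "strict_mono (r :: nat \<Rightarrow> nat)" and x: "(\<lambda>j. X (r j)) \<longlonglongrightarrow> x"
  shows "x \<in> K" "0 \<in> F x"
proof -
  show "x \<in> K" using x by (rule limit_in_K)
  have r_lim: "filterlim r at_top sequentially" by (rule filterlim_subseq[OF r])
  have Y_r: "(\<lambda>j. Y (r j)) \<longlonglongrightarrow> x" using Y_tendsto_iff_X_tendsto[OF r_lim] x by blast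
  obtain c where c: "(\<lambda>k. h (Y k)) \<longlonglongrightarrow> c" using convergent_h_Y by (auto simp: convergent_def)
  have "h x = c" by (rule LIMSEQ_unique[OF h_tendsto[OF Y_r] filterlim_compose[OF c r_lim]])
  show "0 \<in> F x"
  proof (rule stationary_limit_if_no_descent[OF r_lim Y_r zero_less_one])
    fix e :: real assume "e > 0"
    then have "\<forall>\<^sub>F k in sequentially. h x - e < h (Y k)"
      using \<open>h x = c\<close> by (intro order_tendstoD(1)[OF c]) simp
    then obtain N where N: "\<And>k. k \<ge> N \<Longrightarrow> h x - e < h (Y k)" by (auto simp: eventually_sequentially)
    have "\<forall>\<^sub>F j in sequentially. N \<le> r j" using r_lim by (simp add: filterlim_at_top)
    then show "\<forall>\<^sub>F j in sequentially. \<forall>k\<ge>r j. time k \<le> time (r j) + 1 \<longrightarrow> h x - e \<le> h (Y k)"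
      by eventually_elim (use N in \<open>auto intro!: less_imp_le\<close>)
  qed
qed

end

section \<open>Potentials of conservative fields\<close>

lemma lipschitz_imp_abs_continuous_on:
  assumes lip: "L-lipschitz_on S \<gamma>"
  shows "abs_continuous_on S \<gamma>"
  unfolding abs_continuous_on_def
proof (intro allI impI)
  fix \<epsilon> :: real assume \<epsilon>: "\<epsilon> > 0"
  have L: "L \<ge> 0" using lip by (rule lipschitz_on_nonneg)
  show "\<exists>\<delta>>0. \<forall>d T. d division_of T \<and> T \<subseteq> S \<and> (\<Sum>k\<in>d. Sup k - Inf k) < \<delta> \<longrightarrow>
        (\<Sum>k\<in>d. norm (\<gamma> (Sup k) - \<gamma> (Inf k))) < \<epsilon>"
  proof (intro exI[of _ "\<epsilon> / (L + 1)"] conjI allI impI)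
    show "\<epsilon> / (L + 1) > 0" using \<epsilon> L by simp
    fix d T
    assume d: "d division_of T \<and> T \<subseteq> S \<and> (\<Sum>k\<in>d. Sup k - Inf k) < \<epsilon> / (L + 1)"
    have "norm (\<gamma> (Sup k) - \<gamma> (Inf k)) \<le> L * (Sup k - Inf k)" if k_in: "k \<in> d" for k
    proof -
      have division: "d division_of T" using d by blast
      obtain a b where "k = cbox a b" using division_ofD(4)[OF division k_in] by blast
      then have k: "k = {a..b}" "k \<noteq> {}" "k \<subseteq> T"
        using division_ofD(2,3)[OF division k_in] by simp_all
      then have a_le_b: "a \<le> b" by simp
      then have "a \<in> S" "b \<in> S" using k d by auto
      then show ?thesis using lipschitz_onD[OF lip, of b a] a_le_b by (simp add: k dist_norm)
    qed
    then have "(\<Sum>k\<in>d. norm (\<gamma> (Sup k) - \<gamma> (Inf k))) \<le> L * (\<Sum>k\<in>d. Sup k - Inf k)"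
      unfolding sum_distrib_left by (rule sum_mono)
    also have "\<dots> \<le> L * (\<epsilon> / (L + 1))" using L d by (intro mult_left_mono) auto
    also have "\<dots> < \<epsilon>" using L \<epsilon> by (simp add: field_simps)
    finally show "(\<Sum>k\<in>d. norm (\<gamma> (Sup k) - \<gamma> (Inf k))) < \<epsilon>" .
  qed
qed

definition difference_quotient :: "(real \<Rightarrow> real) \<Rightarrow> nat \<Rightarrow> real \<Rightarrow> real" where
  "difference_quotient \<psi> n t = (\<psi> (t + inverse (real (Suc n))) - \<psi> t) / inverse (real (Suc n))"

lemma difference_quotient_LIMSEQ:
  assumes "(\<psi> has_real_derivative d) (at t)"
  shows "(\<lambda>n. difference_quotient \<psi> n t) \<longlonglongrightarrow> d"
proof -
  have "filterlim (\<lambda>n. inverse (real (Suc n))) (at 0) sequentially"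
    by (rule filterlim_atI[OF LIMSEQ_inverse_real_of_nat]) auto
  then show ?thesis
    unfolding difference_quotient_def using filterlim_compose[OF assms[unfolded DERIV_def]] by blast
qed

lemma abs_difference_quotient_le:
  assumes "L-lipschitz_on UNIV \<psi>"
  shows "\<bar>difference_quotient \<psi> n t\<bar> \<le> L"
proof -
  define e where "e = inverse (real (Suc n))"
  have "\<bar>\<psi> (t + e) - \<psi> t\<bar> \<le> L * e"
    using lipschitz_onD[OF assms, of "t + e" t] by (simp add: e_def dist_real_def)
  moreover have "0 < e" by (simp add: e_def)
  ultimately show ?thesis
    unfolding difference_quotient_def e_def[symmetric] by (simp add: abs_divide pos_divide_le_eq)
qed

lemma continuous_on_difference_quotient:
  assumes "continuous_on UNIV \<psi>"
  shows "continuous_on S (difference_quotient \<psi> n)"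
  unfolding difference_quotient_def
  by (intro continuous_intros continuous_on_compose2[OF assms]) auto

lemma integral_difference_quotient_LIMSEQ:
  fixes \<psi> :: "real \<Rightarrow> real"
  assumes cont: "continuous_on UNIV \<psi>" and "a \<le> b"
  shows "(\<lambda>n. LINT t|lebesgue_on {a..b}. difference_quotient \<psi> n t) \<longlonglongrightarrow> \<psi> b - \<psi> a"
proof -
  obtain \<Psi> where \<Psi>:
    "\<And>x. x \<in> {a - 1..b + 2} \<Longrightarrow> (\<Psi> has_vector_derivative \<psi> x) (at x within {a - 1..b + 2})"
    using antiderivative_continuous[OF continuous_on_subset[OF cont subset_UNIV]] by blast
  have \<Psi>_deriv: "(\<Psi> has_real_derivative \<psi> x) (at x)" if "x \<in> {a - 1<..<b + 2}" for x
    using \<Psi>[of x] that at_within_interior[of x "{a - 1..b + 2}"]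
    by (simp add: has_real_derivative_iff_has_vector_derivative)
  have "(LINT t|lebesgue_on {a..b}. difference_quotient \<psi> n t) =
      difference_quotient \<Psi> n b - difference_quotient \<Psi> n a" for n
  proof -
    define e where "e = inverse (real (Suc n))"
    have e: "0 < e" "e \<le> 1" by (auto simp: e_def inverse_le_1_iff)
    have "(difference_quotient \<Psi> n has_vector_derivative difference_quotient \<psi> n x) (at x within {a..b})"
      if x: "x \<in> {a..b}" for x
    proof -
      have "((\<lambda>t. \<Psi> (t + e)) has_real_derivative \<psi> (x + e)) (at x)"
        using \<Psi>_deriv[of "x + e"] x e by (simp add: DERIV_shift)
      then have "(difference_quotient \<Psi> n has_real_derivative difference_quotient \<psi> n x) (at x)"
        unfolding difference_quotient_def[abs_def] e_def[symmetric] using \<Psi>_deriv[of x] x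
        by (intro DERIV_cdivide DERIV_diff) auto
      then show ?thesis
        by (simp add: has_real_derivative_iff_has_vector_derivative has_vector_derivative_at_within)
    qed
    then have "(difference_quotient \<psi> n has_integral
        (difference_quotient \<Psi> n b - difference_quotient \<Psi> n a)) {a..b}"
      by (rule fundamental_theorem_of_calculus[OF \<open>a \<le> b\<close>])
    moreover have "integrable (lebesgue_on {a..b}) (difference_quotient \<psi> n)"
      by (rule continuous_imp_integrable_real[OF continuous_on_difference_quotient[OF cont]])
    ultimately show ?thesis by (simp add: lebesgue_integral_eq_integral integral_unique)
  qed
  moreover have "(\<lambda>n. difference_quotient \<Psi> n x) \<longlonglongrightarrow> \<psi> x" if "x \<in> {a..b}" for x
    using that by (intro difference_quotient_LIMSEQ \<Psi>_deriv) auto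
  ultimately show ?thesis using \<open>a \<le> b\<close> by (auto intro!: tendsto_diff)
qed

lemma lipschitz_increment_le_integral:
  fixes \<psi> g :: "real \<Rightarrow> real"
  assumes lip: "L-lipschitz_on UNIV \<psi>" and "a \<le> b"
    and deriv: "AE t in lebesgue_on {a..b}. \<exists>d. (\<psi> has_real_derivative d) (at t) \<and> d \<le> g t"
    and g: "integrable (lebesgue_on {a..b}) g"
  shows "\<psi> b - \<psi> a \<le> (LINT t|lebesgue_on {a..b}. g t)"
proof -
  let ?M = "lebesgue_on {a..b}"
  define D where "D t = lim (\<lambda>n. difference_quotient \<psi> n t)" for t
  have cont: "continuous_on UNIV \<psi>" by (rule lipschitz_on_continuous_on[OF lip])
  have meas: "difference_quotient \<psi> n \<in> borel_measurable ?M" for n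
    by (intro continuous_imp_measurable_on_sets_lebesgue continuous_on_difference_quotient[OF cont]) auto
  have D_meas: "D \<in> borel_measurable ?M"
    unfolding D_def by (intro borel_measurable_lim_metric meas)
  have "AE t in ?M. (\<lambda>n. difference_quotient \<psi> n t) \<longlonglongrightarrow> D t \<and> D t \<le> g t"
    using deriv by eventually_elim (auto simp: D_def limI dest!: difference_quotient_LIMSEQ)
  then have AE_lim: "AE t in ?M. (\<lambda>n. difference_quotient \<psi> n t) \<longlonglongrightarrow> D t"
    and AE_le: "AE t in ?M. D t \<le> g t"
    by auto
  have "integrable ?M (\<lambda>t. L)" by (intro continuous_imp_integrable_real continuous_on_const)
  moreover have "AE t in ?M. norm (difference_quotient \<psi> n t) \<le> L" for n
    using abs_difference_quotient_le[OF lip] by simp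
  ultimately have D_int: "integrable ?M D"
    and lim: "(\<lambda>n. LINT t|?M. difference_quotient \<psi> n t) \<longlonglongrightarrow> (LINT t|?M. D t)"
    using D_meas meas AE_lim
    by (blast intro: integrable_dominated_convergence, blast intro: integral_dominated_convergence)
  have "\<psi> b - \<psi> a = (LINT t|?M. D t)"
    by (rule LIMSEQ_unique[OF integral_difference_quotient_LIMSEQ[OF cont \<open>a \<le> b\<close>] lim])
  also have "\<dots> \<le> (LINT t|?M. g t)" by (rule integral_mono_AE[OF D_int g AE_le])
  finally show ?thesis .
qed

lemma C1_imp_lipschitz_on_bounded:
  fixes A :: "'a::euclidean_space \<Rightarrow> 'b::real_normed_vector"
  assumes deriv: "\<And>x. (A has_derivative J x) (at x)"
    and cont: "\<And>v. continuous_on UNIV (\<lambda>x. J x v)"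
    and "bounded B"
  obtains L where "L-lipschitz_on B A"
proof -
  obtain r where r: "B \<subseteq> cball 0 r"
    using \<open>bounded B\<close> unfolding bounded_iff subset_iff mem_cball_0 by blast
  define J' where "J' x = Blinfun (J x)" for x
  have J': "blinfun_apply (J' x) = J x" for x
    using deriv by (auto simp: J'_def intro!: bounded_linear_Blinfun_apply has_derivative_bounded_linear)
  have "continuous_on (cball 0 r) J'"
    by (intro continuous_on_blinfun_componentwise) (auto simp: J' intro: continuous_on_subset[OF cont])
  then have "bounded (J' ` cball 0 r)" by (intro compact_imp_bounded compact_continuous_image) auto
  then obtain C where C: "\<And>x. x \<in> cball 0 r \<Longrightarrow> norm (J' x) \<le> C" unfolding bounded_iff by blast
  have "\<bar>C\<bar>-lipschitz_on (cball 0 r) A"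
  proof (rule lipschitz_onI)
    fix x y :: 'a assume xy: "x \<in> cball 0 r" "y \<in> cball 0 r"
    have "norm (A x - A y) \<le> \<bar>C\<bar> * norm (x - y)"
    proof (rule differentiable_bound[OF convex_cball _ _ xy])
      show "(A has_derivative J z) (at z within cball 0 r)" for z
        by (rule has_derivative_at_withinI[OF deriv])
      show "onorm (J z) \<le> \<bar>C\<bar>" if "z \<in> cball 0 r" for z
        using C[OF that] by (simp add: norm_blinfun.rep_eq J')
    qed
    then show "dist (A x) (A y) \<le> \<bar>C\<bar> * dist x y" by (simp add: dist_norm)
  qed simp
  then show ?thesis using that lipschitz_on_subset[OF _ r] by blast
qed

lemma inner_between_min_max_speed:
  assumes "compact (D (\<gamma> t))" and u: "u \<in> D (\<gamma> t)"
  shows "min_speed D \<gamma> t \<le> vector_derivative \<gamma> (at t within {0..1}) \<bullet> u"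
    and "vector_derivative \<gamma> (at t within {0..1}) \<bullet> u \<le> max_speed D \<gamma> t"
proof -
  let ?f = "\<lambda>v. vector_derivative \<gamma> (at t within {0..1}) \<bullet> v"
  have "compact (?f ` D (\<gamma> t))"
    by (intro compact_continuous_image assms continuous_intros)
  then have bdd: "bdd_above (?f ` D (\<gamma> t))" "bdd_below (?f ` D (\<gamma> t))"
    by (auto dest: compact_imp_bounded bounded_imp_bdd_above bounded_imp_bdd_below)
  show "min_speed D \<gamma> t \<le> ?f u" unfolding min_speed_def by (rule cINF_lower[OF bdd(2) u])
  show "?f u \<le> max_speed D \<gamma> t" unfolding max_speed_def by (rule cSUP_upper[OF u bdd(1)])
qed

lemma potential_chain_rule:
  assumes cons: "conservative_field D" and pot: "admits_potential D f"
    and ac: "abs_continuous_on {0..1} \<gamma>"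
  shows "AE t in lebesgue_on {0..1}. \<forall>u\<in>D (\<gamma> t).
    max_speed D \<gamma> t = vector_derivative \<gamma> (at t within {0..1}) \<bullet> u"
proof -
  let ?M = "lebesgue_on {0..1::real}"
  have D: "compact (D x)" "D x \<noteq> {}" for x using cons unfolding conservative_field_def by auto
  have integrable: "integrable ?M (max_speed D \<gamma>)" "integrable ?M (min_speed D \<gamma>)"
    and "(LINT t|?M. max_speed D \<gamma> t) = (LINT t|?M. min_speed D \<gamma> t)"
    using pot[unfolded admits_potential_def, rule_format, of \<gamma> "\<gamma> 0" "\<gamma> 1"] ac by simp_all
  then have "(LINT t|?M. max_speed D \<gamma> t - min_speed D \<gamma> t) = 0" by simp
  moreover have "min_speed D \<gamma> t \<le> max_speed D \<gamma> t" for t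
    using inner_between_min_max_speed[of D \<gamma> t] D by (meson equals0I order_trans)
  ultimately have "AE t in ?M. max_speed D \<gamma> t - min_speed D \<gamma> t = 0"
    using integral_nonneg_eq_0_iff_AE[of ?M "\<lambda>t. max_speed D \<gamma> t - min_speed D \<gamma> t"] integrable by simp
  then show ?thesis
  proof eventually_elim
    case (elim t)
    then show ?case using inner_between_min_max_speed[of D \<gamma> t] D by (force intro: order_antisym)
  qed
qed

lemma potential_decrease_ge:
  assumes cons: "conservative_field D" and pot: "admits_potential D f"
    and ac: "abs_continuous_on {0..1} \<alpha>" and \<psi>: "L-lipschitz_on UNIV \<psi>"
    and speed_le: "AE t in lebesgue_on {0..1}. \<exists>d. \<exists>u\<in>D (\<alpha> t). (\<psi> has_real_derivative d) (at t) \<and>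
       d \<le> - (vector_derivative \<alpha> (at t within {0..1}) \<bullet> u)"
  shows "\<psi> 1 - \<psi> 0 \<le> f (\<alpha> 0) - f (\<alpha> 1)"
proof -
  let ?M = "lebesgue_on {0..1::real}"
  have integrable: "integrable ?M (max_speed D \<alpha>)"
    and f_end: "f (\<alpha> 1) = f (\<alpha> 0) + (LINT t|?M. max_speed D \<alpha> t)"
    using pot[unfolded admits_potential_def, rule_format, of \<alpha> "\<alpha> 0" "\<alpha> 1"] ac by simp_all
  have "AE t in ?M. \<exists>d. (\<psi> has_real_derivative d) (at t) \<and> d \<le> - max_speed D \<alpha> t"
    using speed_le potential_chain_rule[OF cons pot ac] by eventually_elim auto
  then have "\<psi> 1 - \<psi> 0 \<le> (LINT t|?M. - max_speed D \<alpha> t)"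
    using integrable by (intro lipschitz_increment_le_integral[OF \<psi>]) auto
  then show ?thesis using f_end by simp
qed

lemma vector_derivative_compose_has_derivative:
  assumes \<delta>: "(\<delta> has_vector_derivative v) (at t)" and A: "(A has_derivative J) (at (\<delta> t))"
    and t: "t \<in> {a..b}" "a < b"
  shows "vector_derivative (\<lambda>t. A (\<delta> t)) (at t within {a..b}) = J v"
proof -
  have "((\<lambda>t. A (\<delta> t)) has_derivative (\<lambda>h. J (h *\<^sub>R v))) (at t)"
    by (rule has_derivative_compose[OF \<delta>[unfolded has_vector_derivative_def] A])
  then have "((\<lambda>t. A (\<delta> t)) has_vector_derivative J v) (at t)"
    by (simp add: has_vector_derivative_def linear_scale[OF has_derivative_linear[OF A]])
  then have "((\<lambda>t. A (\<delta> t)) has_vector_derivative J v) (at t within {a..b})"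
    by (rule has_vector_derivative_at_within)
  then show ?thesis
    using t by (intro vector_derivative_within_cbox[of a b, unfolded box_real]) auto
qed

lemma has_real_derivative_compose_gradient:
  assumes \<delta>: "(\<delta> has_vector_derivative v) (at t)"
    and q: "(q has_derivative (\<lambda>h. b \<bullet> h)) (at (\<delta> t))"
  shows "((\<lambda>t. q (\<delta> t)) has_real_derivative b \<bullet> v) (at t)"
  unfolding has_field_derivative_def
  by (rule has_derivative_eq_rhs[OF has_derivative_compose[OF \<delta>[unfolded has_vector_derivative_def] q]])
    (simp add: fun_eq_iff)

lemma composite_potential_decrease_ge:
  fixes A :: "'a::euclidean_space \<Rightarrow> 'b::euclidean_space"
  assumes cons: "conservative_field D" and pot: "admits_potential D f"
    and A: "\<And>x. (A has_derivative J x) (at x)" and J_cont: "\<And>v. continuous_on UNIV (\<lambda>x. J x v)"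
    and q: "\<And>x. (q has_derivative (\<lambda>v. b x \<bullet> v)) (at x)" and b_cont: "continuous_on UNIV b"
    and \<delta>: "L-lipschitz_on UNIV \<delta>" "bounded (range \<delta>)" and \<psi>: "M-lipschitz_on UNIV \<psi>"
    and speed_le: "AE t in lebesgue_on {0..1}. \<exists>v d. \<exists>u\<in>D (A (\<delta> t)). (\<delta> has_vector_derivative v) (at t) \<and>
       (\<psi> has_real_derivative d) (at t) \<and> d \<le> - (v \<bullet> (adjoint (J (\<delta> t)) u + b (\<delta> t)))"
  shows "\<psi> 1 - \<psi> 0 \<le> (f (A (\<delta> 0)) + q (\<delta> 0)) - (f (A (\<delta> 1)) + q (\<delta> 1))"
proof -
  obtain L\<^sub>A where L\<^sub>A: "L\<^sub>A-lipschitz_on (range \<delta>) A"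
    by (rule C1_imp_lipschitz_on_bounded[OF A J_cont \<delta>(2)])
  obtain L\<^sub>q where L\<^sub>q: "L\<^sub>q-lipschitz_on (range \<delta>) q"
    by (rule C1_imp_lipschitz_on_bounded[OF q _ \<delta>(2)]) (intro continuous_intros b_cont)
  have "(L\<^sub>A * L)-lipschitz_on {0..1} (\<lambda>t. A (\<delta> t))"
    using lipschitz_on_compose2[OF \<delta>(1) L\<^sub>A] by (rule lipschitz_on_subset) simp
  then have \<alpha>: "abs_continuous_on {0..1} (\<lambda>t. A (\<delta> t))" by (rule lipschitz_imp_abs_continuous_on)
  have "(M + L\<^sub>q * L)-lipschitz_on UNIV (\<lambda>t. \<psi> t + q (\<delta> t))"
    by (intro lipschitz_on_add \<psi> lipschitz_on_compose2[OF \<delta>(1) L\<^sub>q])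
  then have "(\<psi> 1 + q (\<delta> 1)) - (\<psi> 0 + q (\<delta> 0)) \<le> f (A (\<delta> 0)) - f (A (\<delta> 1))"
  proof (rule potential_decrease_ge[OF cons pot \<alpha>])
    show "AE t in lebesgue_on {0..1}. \<exists>d. \<exists>u\<in>D (A (\<delta> t)).
       ((\<lambda>t. \<psi> t + q (\<delta> t)) has_real_derivative d) (at t) \<and>
       d \<le> - (vector_derivative (\<lambda>t. A (\<delta> t)) (at t within {0..1}) \<bullet> u)"
      using speed_le AE_space
    proof eventually_elim
      case (elim t)
      then obtain v d u where u: "u \<in> D (A (\<delta> t))" and v: "(\<delta> has_vector_derivative v) (at t)"
        and d: "(\<psi> has_real_derivative d) (at t)" "d \<le> - (v \<bullet> (adjoint (J (\<delta> t)) u + b (\<delta> t)))"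
        and t: "t \<in> {0..1}" by auto
      have "vector_derivative (\<lambda>t. A (\<delta> t)) (at t within {0..1}) = J (\<delta> t) v"
        by (rule vector_derivative_compose_has_derivative[OF v A t]) simp
      moreover have "v \<bullet> adjoint (J (\<delta> t)) u = J (\<delta> t) v \<bullet> u"
        by (rule adjoint_works[OF has_derivative_linear[OF A]])
      moreover have "((\<lambda>t. \<psi> t + q (\<delta> t)) has_real_derivative d + b (\<delta> t) \<bullet> v) (at t)"
        by (rule DERIV_add[OF d(1) has_real_derivative_compose_gradient[OF v q]])
      ultimately show ?case
        using u d(2) by (intro exI[of _ "d + b (\<delta> t) \<bullet> v"] bexI[of _ u])
          (auto simp: inner_add_right inner_commute)
    qed
  qed
  then show ?thesis by simp
qed

lemma path_differentiable_imp_AE_differentiable: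
  fixes f :: "'a::euclidean_space \<Rightarrow> real" and \<gamma> :: "real \<Rightarrow> 'a"
  assumes "path_differentiable f" and lip: "L-lipschitz_on UNIV \<gamma>"
  shows "AE t in lebesgue_on {0..1}. 0 < t \<and> t < 1 \<and> (\<exists>v. (\<gamma> has_vector_derivative v) (at t))"
proof -
  have "abs_continuous_on {0..} \<gamma>"
    by (rule lipschitz_imp_abs_continuous_on[OF lipschitz_on_subset[OF lip]]) simp
  then have "AE t in lebesgue. 0 \<le> t \<longrightarrow> (\<exists>v. (\<gamma> has_vector_derivative v) (at t within {0..}))"
    using assms(1)[unfolded path_differentiable_def, rule_format, of \<gamma>]
    by (auto elim!: AE_mp)
  moreover have "AE t in lebesgue. t \<noteq> (0::real)" "AE t in lebesgue. t \<noteq> (1::real)"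
    by (auto intro!: AE_completion AE_lborel_singleton)
  ultimately have "AE t in lebesgue. t \<in> {0..1} \<longrightarrow>
      0 < t \<and> t < 1 \<and> (\<exists>v. (\<gamma> has_vector_derivative v) (at t))"
  proof eventually_elim
    case (elim t)
    have "at t within {0..} = at t" if "0 < t"
      using that by (intro at_within_interior) simp
    then show ?case using elim by force
  qed
  then show ?thesis by (subst AE_restrict_space_iff) auto
qed

definition rescaled_curve :: "real \<Rightarrow> (real \<Rightarrow> 'a) \<Rightarrow> real \<Rightarrow> 'a" where
  "rescaled_curve T \<gamma> t = \<gamma> (T * clamp 0 1 t)"

lemma rescaled_curve_eq: "t \<in> {0..1} \<Longrightarrow> rescaled_curve T \<gamma> t = \<gamma> (T * t)"
  by (simp add: rescaled_curve_def)

lemma rescaled_curve_lipschitz_bounded: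
  fixes \<gamma> :: "real \<Rightarrow> 'a::metric_space"
  assumes T: "0 \<le> T" and lip: "L-lipschitz_on {0..T} \<gamma>"
  shows "(L * T)-lipschitz_on UNIV (rescaled_curve T \<gamma>)" "bounded (range (rescaled_curve T \<gamma>))"
proof -
  have clamp: "clamp 0 1 t \<in> {0..1}" for t :: real using clamp_in_interval[of 0 1 t] by simp
  then have T_clamp: "T * clamp 0 1 t \<in> {0..T}" for t using T by (simp add: mult_left_le)
  show "(L * T)-lipschitz_on UNIV (rescaled_curve T \<gamma>)"
  proof (rule lipschitz_onI)
    fix s t :: real
    have "dist (rescaled_curve T \<gamma> s) (rescaled_curve T \<gamma> t) \<le>
        L * dist (T * clamp 0 1 s) (T * clamp 0 1 t)"
      unfolding rescaled_curve_def by (rule lipschitz_onD[OF lip T_clamp T_clamp])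
    also have "\<dots> = L * T * dist (clamp 0 1 s) (clamp 0 1 t)"
      using T by (simp add: dist_real_def abs_mult flip: right_diff_distrib)
    also have "\<dots> \<le> L * T * dist s t"
      using T lipschitz_on_nonneg[OF lip] by (intro mult_left_mono dist_clamps_le_dist_args) auto
    finally show "dist (rescaled_curve T \<gamma> s) (rescaled_curve T \<gamma> t) \<le> L * T * dist s t" .
  qed (use T lipschitz_on_nonneg[OF lip] in simp)
  have "bounded (\<gamma> ` {0..T})"
    by (intro compact_imp_bounded compact_continuous_image lipschitz_on_continuous_on[OF lip] compact_Icc)
  then show "bounded (range (rescaled_curve T \<gamma>))"
    by (rule bounded_subset) (use T_clamp in \<open>auto simp: rescaled_curve_def\<close>)
qed

lemma has_vector_derivative_if_rescaled_curve:
  assumes T: "0 < T" and t: "0 < t" "t < 1"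
    and deriv: "(rescaled_curve T \<gamma> has_vector_derivative v) (at t)"
  shows "(\<gamma> has_vector_derivative v /\<^sub>R T) (at (T * t))"
proof (rule has_vector_derivative_transform_within_open)
  have "((\<lambda>s. s / T) has_real_derivative 1 / T) (at (T * t))"
    using T by (auto intro!: derivative_eq_intros)
  moreover have "(rescaled_curve T \<gamma> has_vector_derivative v) (at (T * t / T))" using deriv T by simp
  ultimately show "((\<lambda>s. rescaled_curve T \<gamma> (s / T)) has_vector_derivative v /\<^sub>R T) (at (T * t))"
    using vector_diff_chain_at[of "\<lambda>s. s / T" "1 / T" "T * t" "rescaled_curve T \<gamma>" v]
    by (simp add: has_real_derivative_iff_has_vector_derivative o_def divide_inverse)
  show "rescaled_curve T \<gamma> (s / T) = \<gamma> s" if "s \<in> {0<..<T}" for s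
    using that T by (simp add: rescaled_curve_eq)
qed (use t T in auto)

lemma descent_curve_rescaled:
  fixes f :: "'a::euclidean_space \<Rightarrow> real" and \<gamma> :: "real \<Rightarrow> 'a"
  assumes path: "path_differentiable f" and \<gamma>: "descent_curve F T \<gamma>" and T: "0 < T"
  shows "AE t in lebesgue_on {0..1}. \<exists>v. (rescaled_curve T \<gamma> has_vector_derivative v) (at t) \<and>
    - (v /\<^sub>R T) \<in> F (rescaled_curve T \<gamma> t)"
proof -
  obtain L where "L-lipschitz_on {0..T} \<gamma>" using \<gamma> unfolding descent_curve_def by blast
  then have "(L * T)-lipschitz_on UNIV (rescaled_curve T \<gamma>)"
    by (rule rescaled_curve_lipschitz_bounded[OF less_imp_le[OF T]])
  from path_differentiable_imp_AE_differentiable[OF path this] show ?thesis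
  proof eventually_elim
    case (elim t)
    then obtain v where t: "0 < t" "t < 1"
      and v: "(rescaled_curve T \<gamma> has_vector_derivative v) (at t)" by blast
    have "T * t \<in> {0<..<T}" using t T by simp
    then have "- (v /\<^sub>R T) \<in> F (\<gamma> (T * t))"
      using \<gamma> has_vector_derivative_if_rescaled_curve[OF T t v] unfolding descent_curve_def by blast
    then show ?case using v t by (auto simp: rescaled_curve_eq)
  qed
qed

lemma lipschitz_on_inner: "(norm w)-lipschitz_on S (\<lambda>x. w \<bullet> x)"
  by (intro lipschitz_onI) (auto simp: dist_norm Cauchy_Schwarz_ineq2 simp flip: inner_diff_right)

text \<open>For \<open>w = \<gamma> T - \<gamma> 0\<close>, integrating \<open>\<parallel>\<gamma>'\<parallel>\<^sup>2 \<ge> 2 (w \<bullet> \<gamma>') / T - \<parallel>w\<parallel>\<^sup>2 / T\<^sup>2\<close> gives the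
  bound \<open>\<integral>\<parallel>\<gamma>'\<parallel>\<^sup>2 \<ge> \<parallel>w\<parallel>\<^sup>2 / T\<close> on the decrease.\<close>

lemma lyapunov_function_composite:
  fixes f q :: "'a::euclidean_space \<Rightarrow> real"
  assumes path: "path_differentiable f" and cons: "conservative_field D" and pot: "admits_potential D f"
    and A: "\<And>x. (A has_derivative J x) (at x)" and J_cont: "\<And>v. continuous_on UNIV (\<lambda>x. J x v)"
    and q: "\<And>x. (q has_derivative (\<lambda>v. b x \<bullet> v)) (at x)" and b_cont: "continuous_on UNIV b"
  shows "lyapunov_function (\<lambda>x. (\<lambda>u. adjoint (J x) u + b x) ` D (A x)) (\<lambda>x. f (A x) + q x)"
  unfolding lyapunov_function_def
proof (intro allI impI)
  fix \<gamma> :: "real \<Rightarrow> 'a" and T :: real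
  assume T: "0 < T" and \<gamma>: "descent_curve (\<lambda>x. (\<lambda>u. adjoint (J x) u + b x) ` D (A x)) T \<gamma>"
  obtain L where lip: "L-lipschitz_on {0..T} \<gamma>" using \<gamma> unfolding descent_curve_def by blast
  define \<delta> where "\<delta> = rescaled_curve T \<gamma>"
  have \<delta>: "(L * T)-lipschitz_on UNIV \<delta>" "bounded (range \<delta>)"
    unfolding \<delta>_def using rescaled_curve_lipschitz_bounded[OF less_imp_le[OF T] lip] by auto
  have ends: "\<delta> 0 = \<gamma> 0" "\<delta> 1 = \<gamma> T" by (simp_all add: \<delta>_def rescaled_curve_eq)
  define w where "w = \<gamma> T - \<gamma> 0"
  define \<psi> where "\<psi> t = 1 / T * (2 * (w \<bullet> \<delta> t) - (norm w)\<^sup>2 * t)" for t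
  have "\<exists>M. M-lipschitz_on UNIV \<psi>"
    unfolding \<psi>_def
    by (rule exI, rule lipschitz_on_cmult_real, rule lipschitz_on_diff)
      (rule lipschitz_on_cmult_real,
        rule lipschitz_on_compose2[OF \<delta>(1) lipschitz_on_inner] lipschitz_on_id)+
  then obtain M where \<psi>: "M-lipschitz_on UNIV \<psi>" by blast
  have "AE t in lebesgue_on {0..1}. \<exists>v d. \<exists>u\<in>D (A (\<delta> t)). (\<delta> has_vector_derivative v) (at t) \<and>
       (\<psi> has_real_derivative d) (at t) \<and> d \<le> - (v \<bullet> (adjoint (J (\<delta> t)) u + b (\<delta> t)))"
    using descent_curve_rescaled[OF path \<gamma> T, folded \<delta>_def]
  proof eventually_elim
    case (elim t)
    then obtain v u where v: "(\<delta> has_vector_derivative v) (at t)"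
      and u: "u \<in> D (A (\<delta> t))" "adjoint (J (\<delta> t)) u + b (\<delta> t) = - (v /\<^sub>R T)" by force
    have "((\<lambda>t. w \<bullet> \<delta> t) has_real_derivative w \<bullet> v) (at t)"
      by (rule has_real_derivative_compose_gradient[OF v])
        (rule has_derivative_inner_right[OF has_derivative_ident])
    then have "(\<psi> has_real_derivative (2 * (w \<bullet> v) - (norm w)\<^sup>2) / T) (at t)"
      unfolding \<psi>_def using T by (auto intro!: derivative_eq_intros)
    moreover have "(2 * (w \<bullet> v) - (norm w)\<^sup>2) / T \<le> (v \<bullet> v) / T"
      using inner_ge_zero[of "w - v"] T
      by (intro divide_right_mono) (auto simp: power2_norm_eq_inner inner_diff inner_commute)
    moreover have "- (v \<bullet> (adjoint (J (\<delta> t)) u + b (\<delta> t))) = (v \<bullet> v) / T"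
      by (simp add: u(2) divide_inverse mult.commute)
    ultimately show ?case using u(1) v by force
  qed
  from composite_potential_decrease_ge[OF cons pot A J_cont q b_cont \<delta> \<psi> this]
  have "\<psi> 1 - \<psi> 0 \<le> (f (A (\<gamma> 0)) + q (\<gamma> 0)) - (f (A (\<gamma> T)) + q (\<gamma> T))" by (simp add: ends)
  moreover have "\<psi> 1 - \<psi> 0 = (norm (\<gamma> T - \<gamma> 0))\<^sup>2 / T"
    by (simp add: \<psi>_def ends w_def power2_norm_eq_inner inner_diff_right flip: diff_divide_distrib)
  ultimately show "(norm (\<gamma> T - \<gamma> 0))\<^sup>2 / T \<le> f (A (\<gamma> 0)) + q (\<gamma> 0) - (f (A (\<gamma> T)) + q (\<gamma> T))"
    by simp
qed

section \<open>Frobenius geometry near the Stiefel manifold\<close>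

lemma inner_transpose_transpose:
  fixes A B :: "real^'n^'m"
  shows "transpose A \<bullet> transpose B = A \<bullet> B"
  unfolding inner_vec_def transpose_def by (simp add: sum.swap[of _ "UNIV :: 'm set"])

lemma norm_transpose [simp]:
  fixes A :: "real^'n^'m"
  shows "norm (transpose A) = norm A"
  by (simp add: norm_eq_sqrt_inner inner_transpose_transpose)

lemma inner_matrix_mult_right:
  fixes A :: "real^'k^'m" and B :: "real^'n^'k" and C :: "real^'n^'m"
  shows "(A ** B) \<bullet> C = A \<bullet> (C ** transpose B)"
proof -
  have "(\<Sum>j\<in>UNIV. (\<Sum>k\<in>UNIV. A $ i $ k * B $ k $ j) * C $ i $ j) =
        (\<Sum>k\<in>UNIV. A $ i $ k * (\<Sum>j\<in>UNIV. C $ i $ j * B $ k $ j))" for i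
    unfolding sum_distrib_left sum_distrib_right
    by (subst sum.swap) (simp add: mult_ac)
  then show ?thesis
    by (simp add: inner_vec_def matrix_matrix_mult_def transpose_def)
qed

lemma inner_matrix_mult_left:
  fixes A :: "real^'k^'m" and B :: "real^'n^'k" and C :: "real^'n^'m"
  shows "(A ** B) \<bullet> C = B \<bullet> (transpose A ** C)"
proof -
  have "(A ** B) \<bullet> C = (transpose B ** transpose A) \<bullet> transpose C"
    by (simp add: inner_transpose_transpose flip: matrix_transpose_mul)
  also have "\<dots> = transpose B \<bullet> transpose (transpose A ** C)"
    by (simp add: inner_matrix_mult_right matrix_transpose_mul)
  finally show ?thesis by (simp add: inner_transpose_transpose)
qed

lemma norm_vec_power2:
  fixes x :: "'a::real_inner^'n"
  shows "(norm x)\<^sup>2 = (\<Sum>i\<in>UNIV. (norm (x $ i))\<^sup>2)"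
  unfolding power2_norm_eq_inner by (simp add: inner_vec_def)

lemma norm_matrix_mult_le:
  fixes A :: "real^'k^'m" and B :: "real^'n^'k"
  assumes "norm A \<le> a" "norm B \<le> b"
  shows "norm (A ** B) \<le> a * b"
proof -
  have entry: "((A ** B) $ i $ j)\<^sup>2 \<le> (norm (A $ i))\<^sup>2 * (norm (transpose B $ j))\<^sup>2" for i j
  proof -
    have "(A ** B) $ i $ j = A $ i \<bullet> transpose B $ j"
      by (simp add: matrix_matrix_mult_def inner_vec_def transpose_def)
    then show ?thesis using Cauchy_Schwarz_ineq[of "A $ i" "transpose B $ j"]
      by (simp add: power2_norm_eq_inner)
  qed
  have "(norm (A ** B))\<^sup>2 = (\<Sum>i\<in>UNIV. \<Sum>j\<in>UNIV. ((A ** B) $ i $ j)\<^sup>2)"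
    by (simp add: norm_vec_power2)
  also have "\<dots> \<le> (\<Sum>i\<in>UNIV. \<Sum>j\<in>UNIV. (norm (A $ i))\<^sup>2 * (norm (transpose B $ j))\<^sup>2)"
    by (intro sum_mono entry)
  also have "\<dots> = (norm A)\<^sup>2 * (norm (transpose B))\<^sup>2"
    by (simp only: norm_vec_power2[of A] norm_vec_power2[of "transpose B"] sum_product)
  also have "\<dots> = (norm A * norm B)\<^sup>2" by (simp add: power_mult_distrib)
  finally have "norm (A ** B) \<le> norm A * norm B" by (rule power2_le_imp_le) simp
  also have "\<dots> \<le> a * b" using assms by (intro mult_mono) (auto intro: order_trans[OF norm_ge_zero])
  finally show ?thesis .
qed

lemma bounded_bilinear_matrix_mult:
  "bounded_bilinear ((**) :: real^'k^'m \<Rightarrow> real^'n^'k \<Rightarrow> real^'n^'m)"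
proof
  show "\<exists>K. \<forall>(A::real^'k^'m) (B::real^'n^'k). norm (A ** B) \<le> norm A * norm B * K"
    using norm_matrix_mult_le by (intro exI[of _ 1]) auto
qed (auto simp: matrix_matrix_mult_def vec_eq_iff algebra_simps sum.distrib sum_distrib_left)

lemma bounded_linear_transpose: "bounded_linear (transpose :: real^'n^'m \<Rightarrow> real^'m^'n)"
proof (rule bounded_linear_intro[where K = 1])
  show "norm (transpose A) \<le> norm A * 1" for A :: "real^'n^'m" by simp
qed (auto simp: transpose_def vec_eq_iff)

lemmas matrix_mult_distribs =
  bounded_bilinear.add_left[OF bounded_bilinear_matrix_mult]
  bounded_bilinear.add_right[OF bounded_bilinear_matrix_mult]
  bounded_bilinear.diff_left[OF bounded_bilinear_matrix_mult]
  bounded_bilinear.diff_right[OF bounded_bilinear_matrix_mult]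

lemmas matrix_mult_scaleR =
  bounded_bilinear.scaleR_left[OF bounded_bilinear_matrix_mult]
  bounded_bilinear.scaleR_right[OF bounded_bilinear_matrix_mult]

lemmas matrix_mult_expand =
  matrix_mult_distribs matrix_mult_scaleR matrix_mul_assoc matrix_mul_lid matrix_mul_rid

lemmas transpose_distribs =
  linear_add[OF bounded_linear.linear[OF bounded_linear_transpose]]
  linear_diff[OF bounded_linear.linear[OF bounded_linear_transpose]]
  transpose_scalar

lemmas continuous_on_matrix_mult [continuous_intros] =
  bounded_bilinear.continuous_on[OF bounded_bilinear_matrix_mult]

lemmas continuous_on_transpose [continuous_intros] =
  bounded_linear.continuous_on[OF bounded_linear_transpose]

lemmas has_derivative_matrix_mult [derivative_intros] =
  bounded_bilinear.FDERIV[OF bounded_bilinear_matrix_mult]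

lemmas has_derivative_transpose [derivative_intros] =
  bounded_linear.has_derivative[OF bounded_linear_transpose]

definition gram_defect :: "real^'p^'n \<Rightarrow> real^'p^'p" where
  "gram_defect X = transpose X ** X - mat 1"

lemma gram_eq: "transpose X ** X = mat 1 + gram_defect X"
  by (simp add: gram_defect_def)

lemma transpose_gram_defect [simp]: "transpose (gram_defect X) = gram_defect X"
  by (simp add: gram_defect_def transpose_distribs matrix_transpose_mul)

lemma mem_\<Omega>_iff: "X \<in> \<Omega> r \<longleftrightarrow> norm (gram_defect X) \<le> r"
  by (simp add: \<Omega>_def gram_defect_def)

lemma mem_stiefel_iff: "X \<in> stiefel \<longleftrightarrow> gram_defect X = 0"
  by (simp add: stiefel_def gram_defect_def)

lemma continuous_on_gram_defect [continuous_intros]: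
  "continuous_on S g \<Longrightarrow> continuous_on S (\<lambda>x. gram_defect (g x))"
  unfolding gram_defect_def by (intro continuous_intros)

lemma abs_norm_matrix_mult_power2_diff_le:
  "\<bar>(norm (X ** M))\<^sup>2 - (norm M)\<^sup>2\<bar> \<le> norm (gram_defect X) * (norm M)\<^sup>2"
proof -
  have "(norm (X ** M))\<^sup>2 - (norm M)\<^sup>2 = M \<bullet> (gram_defect X ** M)"
    unfolding power2_norm_eq_inner
    by (simp add: inner_matrix_mult_left matrix_mul_assoc gram_eq matrix_mult_distribs inner_add_right)
  also have "\<bar>\<dots>\<bar> \<le> norm M * norm (gram_defect X ** M)" by (rule Cauchy_Schwarz_ineq2)
  also have "\<dots> \<le> norm M * (norm (gram_defect X) * norm M)"
    by (intro mult_left_mono norm_matrix_mult_le) auto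
  finally show ?thesis by (simp add: power2_eq_square mult_ac)
qed

lemma norm_transpose_matrix_mult_le:
  "norm (transpose X ** U) \<le> sqrt (1 + norm (gram_defect X)) * norm U"
proof (cases "transpose X ** U = 0")
  case False
  let ?V = "transpose X ** U" and ?s = "sqrt (1 + norm (gram_defect X))"
  have "(norm (X ** ?V))\<^sup>2 \<le> (?s * norm ?V)\<^sup>2"
    using abs_norm_matrix_mult_power2_diff_le[of X ?V]
    by (simp add: power_mult_distrib algebra_simps abs_le_iff)
  then have norm_X_mult: "norm (X ** ?V) \<le> ?s * norm ?V" by (rule power2_le_imp_le) simp
  have "norm ?V * norm ?V = ?V \<bullet> ?V" by (simp only: dot_square_norm power2_eq_square)
  also have "\<dots> = U \<bullet> (X ** ?V)" using inner_matrix_mult_left[of "transpose X" U ?V] by simp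
  also have "\<dots> \<le> norm U * norm (X ** ?V)" by (rule norm_cauchy_schwarz)
  also have "\<dots> \<le> norm U * (?s * norm ?V)" by (intro mult_left_mono norm_X_mult) simp
  finally have "norm ?V * norm ?V \<le> (?s * norm U) * norm ?V" by (simp add: mult_ac)
  then show ?thesis using False by simp
qed simp

lemma compact_\<Omega>: "compact (\<Omega> r :: (real^'p^'n) set)"
proof -
  have "closed (\<Omega> r :: (real^'p^'n) set)"
    unfolding \<Omega>_def by (intro closed_Collect_le continuous_intros)
  moreover have "bounded (\<Omega> r :: (real^'p^'n) set)"
  proof -
    let ?I = "mat 1 :: real^'p^'p"
    have "(norm X)\<^sup>2 \<le> norm ?I * (norm ?I + r)" if "X \<in> \<Omega> r" for X :: "real^'p^'n"
    proof -
      have "(norm X)\<^sup>2 = ?I \<bullet> (?I + gram_defect X)"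
        using inner_matrix_mult_left[of X ?I X] by (simp add: power2_norm_eq_inner gram_eq)
      also have "\<dots> \<le> norm ?I * norm (?I + gram_defect X)" by (rule norm_cauchy_schwarz)
      also have "\<dots> \<le> norm ?I * (norm ?I + r)"
        using that norm_triangle_ineq[of ?I "gram_defect X"]
        by (intro mult_left_mono) (auto simp: mem_\<Omega>_iff)
      finally show ?thesis .
    qed
    then show ?thesis
      unfolding bounded_iff using real_le_rsqrt by blast
  qed
  ultimately show ?thesis by (simp add: compact_eq_bounded_closed)
qed

section \<open>The constraint dissolving map and its derivative\<close>

lemma \<A>_eq:
  "\<A> X = (1/8) *\<^sub>R (X ** (8 *\<^sub>R mat 1 - 4 *\<^sub>R gram_defect X + 3 *\<^sub>R (gram_defect X ** gram_defect X)))"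
  unfolding \<A>_def gram_eq
  by (simp only: matrix_mult_expand)
     (simp add: vec_eq_iff algebra_simps)

lemma \<A>_stiefel: "X \<in> stiefel \<Longrightarrow> \<A> X = X"
  by (simp add: \<A>_eq mem_stiefel_iff matrix_mult_scaleR)

lemma gram_defect_\<A>:
  fixes X :: "real^'p^'n"
  defines "c \<equiv> gram_defect X"
  shows "gram_defect (\<A> X) = (1/64) *\<^sub>R (40 *\<^sub>R (c ** c ** c) - 15 *\<^sub>R (c ** c ** c ** c)
           + 9 *\<^sub>R (c ** c ** c ** c ** c))"
proof -
  let ?B = "8 *\<^sub>R mat 1 - 4 *\<^sub>R c + 3 *\<^sub>R (c ** c)"
  have sym: "transpose c = c" by (simp add: c_def)
  have "transpose (\<A> X) ** \<A> X = (1/64) *\<^sub>R (?B ** (transpose X ** X) ** ?B)"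
    by (simp add: \<A>_eq flip: c_def)
       (simp add: matrix_transpose_mul transpose_distribs sym matrix_mult_scaleR matrix_mul_assoc)
  also have "\<dots> = (1/64) *\<^sub>R (?B ** (mat 1 + c) ** ?B)" by (simp add: gram_eq c_def)
  finally show ?thesis
    unfolding gram_defect_def[of "\<A> X"]
    by (simp only: matrix_mult_expand)
       (simp add: vec_eq_iff algebra_simps)
qed

lemma \<A>_mem_\<Omega>:
  assumes X: "X \<in> \<Omega> r" and "r \<le> 1"
  shows "\<A> X \<in> \<Omega> r"
proof -
  define c where "c = gram_defect X"
  have norm_c: "norm c \<le> r" using X by (simp add: c_def mem_\<Omega>_iff)
  have mult_c: "norm (M ** c) \<le> r" if "norm M \<le> r" for M
    using norm_matrix_mult_le[OF that, of c 1] norm_c \<open>r \<le> 1\<close> by simp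
  have "norm (gram_defect (\<A> X)) \<le> (1/64) * (40 * norm (c ** c ** c) + 15 * norm (c ** c ** c ** c)
      + 9 * norm (c ** c ** c ** c ** c))"
    unfolding gram_defect_\<A> c_def[symmetric] norm_scaleR
    by (intro mult_mono norm_triangle_le norm_triangle_le_diff add_mono) auto
  also have "\<dots> \<le> (1/64) * (40 * r + 15 * r + 9 * r)"
    by (intro mult_left_mono add_mono mult_c norm_c) auto
  finally show ?thesis by (simp add: mem_\<Omega>_iff)
qed

definition gram_deriv :: "real^'p^'n \<Rightarrow> real^'p^'n \<Rightarrow> real^'p^'p" where
  "gram_deriv X H = transpose X ** H + transpose H ** X"

lemma has_derivative_gram: "((\<lambda>X. transpose X ** X) has_derivative gram_deriv X) (at X)"
  unfolding gram_deriv_def[abs_def]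
  by (intro has_derivative_matrix_mult has_derivative_transpose has_derivative_ident)

lemma transpose_gram_deriv [simp]: "transpose (gram_deriv X H) = gram_deriv X H"
  by (simp add: gram_deriv_def transpose_distribs matrix_transpose_mul add.commute)

lemma continuous_on_gram_deriv [continuous_intros]:
  "continuous_on S g \<Longrightarrow> continuous_on S (\<lambda>x. gram_deriv (g x) H)"
  unfolding gram_deriv_def by (intro continuous_intros)

lemma inner_gram_deriv:
  assumes "transpose S = S"
  shows "S \<bullet> gram_deriv X H = 2 * ((X ** S) \<bullet> H)"
proof -
  have "S \<bullet> (transpose H ** X) = S \<bullet> (transpose X ** H)"
    using inner_transpose_transpose[of S "transpose X ** H"] assms by (simp add: matrix_transpose_mul)
  moreover have "S \<bullet> (transpose X ** H) = (X ** S) \<bullet> H" by (simp add: inner_matrix_mult_left)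
  ultimately show ?thesis by (simp add: gram_deriv_def inner_add_right)
qed

lemma
  fixes X :: "real^'p^'n"
  defines "P \<equiv> transpose X ** X"
  shows \<J>\<^sub>\<A>_eq: "\<J>\<^sub>\<A> X H = (1/8) *\<^sub>R (H ** (15 *\<^sub>R mat 1 - 10 *\<^sub>R P + 3 *\<^sub>R (P ** P))
       + X ** (3 *\<^sub>R (P ** gram_deriv X H + gram_deriv X H ** P) - 10 *\<^sub>R gram_deriv X H))"
      (is "_ = ?J H")
    and has_derivative_\<A>: "(\<A> has_derivative \<J>\<^sub>\<A> X) (at X)"
proof -
  have "((\<lambda>X. (1/8) *\<^sub>R (X ** (15 *\<^sub>R mat 1 - 10 *\<^sub>R (transpose X ** X)
           + 3 *\<^sub>R ((transpose X ** X) ** (transpose X ** X))))) has_derivative ?J) (at X)"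
    unfolding P_def
    by (rule derivative_eq_intros has_derivative_gram refl)+ (simp add: fun_eq_iff algebra_simps)
  then have deriv: "(\<A> has_derivative ?J) (at X)" by (simp add: \<A>_def[abs_def])
  have "\<J>\<^sub>\<A> X = ?J" unfolding \<J>\<^sub>\<A>_def by (rule frechet_derivative_at[OF deriv, symmetric])
  with deriv show "\<J>\<^sub>\<A> X H = ?J H" "(\<A> has_derivative \<J>\<^sub>\<A> X) (at X)" by simp_all
qed

lemma continuous_on_\<J>\<^sub>\<A>: "continuous_on UNIV (\<lambda>X. \<J>\<^sub>\<A> X H)"
  unfolding \<J>\<^sub>\<A>_eq by (intro continuous_intros)

text \<open>\<open>\<A>\<close> is the gradient of a spectral function, so its derivative is a Hessian.\<close>

lemma \<J>\<^sub>\<A>_symmetric: "\<J>\<^sub>\<A> X H \<bullet> K = H \<bullet> \<J>\<^sub>\<A> X K"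
proof -
  define P where "P = transpose X ** X"
  define B where "B = 15 *\<^sub>R mat 1 - 10 *\<^sub>R P + 3 *\<^sub>R (P ** P)"
  define M where "M Z = 3 *\<^sub>R (P ** Z + Z ** P) - 10 *\<^sub>R Z" for Z
  have P: "transpose P = P" by (simp add: P_def matrix_transpose_mul)
  have B: "transpose B = B" by (simp add: B_def transpose_distribs matrix_transpose_mul P)
  have M_sym: "transpose (M (gram_deriv X H)) = M (gram_deriv X H)" for H
    by (simp add: M_def transpose_distribs matrix_transpose_mul P add.commute)
  have M_adj: "M Z \<bullet> W = Z \<bullet> M W" for Z W
    using inner_matrix_mult_left[of P Z W] inner_matrix_mult_right[of Z P W]
    by (simp add: M_def P inner_add_left inner_add_right inner_diff_left inner_diff_right)
  have XM: "(X ** M (gram_deriv X H)) \<bullet> K = (1/2) * (M (gram_deriv X H) \<bullet> gram_deriv X K)" for H K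
    by (simp add: inner_gram_deriv M_sym)
  have J: "\<J>\<^sub>\<A> X H = (1/8) *\<^sub>R (H ** B + X ** M (gram_deriv X H))" for H
    by (simp add: \<J>\<^sub>\<A>_eq P_def B_def M_def)
  have "(H ** B) \<bullet> K = H \<bullet> (K ** B)" using inner_matrix_mult_right[of H B K] B by simp
  moreover have "(X ** M (gram_deriv X H)) \<bullet> K = H \<bullet> (X ** M (gram_deriv X K))"
    using XM[of H K] XM[of K H] M_adj[of "gram_deriv X H" "gram_deriv X K"] by (simp add: inner_commute)
  ultimately show ?thesis by (simp add: J inner_add_left inner_add_right)
qed

lemma adjoint_\<J>\<^sub>\<A>: "adjoint (\<J>\<^sub>\<A> X) = \<J>\<^sub>\<A> X"
  by (rule adjoint_unique) (simp add: \<J>\<^sub>\<A>_symmetric)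

lemma \<J>\<^sub>\<A>_normal:
  fixes X :: "real^'p^'n"
  defines "c \<equiv> gram_defect X"
  shows "\<J>\<^sub>\<A> X (X ** c) = (15/8) *\<^sub>R (X ** c ** (c ** c))"
proof -
  have sym: "transpose c = c" by (simp add: c_def)
  have P: "transpose X ** X = mat 1 + c" by (simp add: c_def gram_eq)
  have Q: "gram_deriv X (X ** c) = 2 *\<^sub>R c + 2 *\<^sub>R (c ** c)"
  proof -
    have "transpose X ** (X ** c) = c + c ** c"
      by (simp add: matrix_mul_assoc P matrix_mult_distribs)
    moreover have "transpose (X ** c) ** X = c + c ** c"
      by (simp add: matrix_transpose_mul sym P matrix_mult_distribs flip: matrix_mul_assoc)
    ultimately show ?thesis by (simp add: gram_deriv_def scaleR_2)
  qed
  show ?thesis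
    unfolding \<J>\<^sub>\<A>_eq Q P
    by (simp only: matrix_mult_expand)
       (simp add: vec_eq_iff algebra_simps)
qed

section \<open>The penalized iteration\<close>

definition penalty_field ::
  "(real^'p^'n \<Rightarrow> (real^'p^'n) set) \<Rightarrow> real \<Rightarrow> real^'p^'n \<Rightarrow> (real^'p^'n) set" where
  "penalty_field D \<beta> X = (\<lambda>V. \<J>\<^sub>\<A> X V + \<beta> *\<^sub>R (X ** gram_defect X)) ` D (\<A> X)"

lemma compact_penalty_field:
  assumes "conservative_field D"
  shows "compact (penalty_field D \<beta> X)"
  unfolding penalty_field_def
proof (rule compact_continuous_image)
  show "compact (D (\<A> X))" using assms by (simp add: conservative_field_def)
  show "continuous_on (D (\<A> X)) (\<lambda>V. \<J>\<^sub>\<A> X V + \<beta> *\<^sub>R (X ** gram_defect X))"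
    by (intro continuous_intros linear_continuous_on has_derivative_bounded_linear[OF has_derivative_\<A>])
qed

lemma penalty_field_nonempty: "conservative_field D \<Longrightarrow> penalty_field D \<beta> X \<noteq> {}"
  by (simp add: penalty_field_def conservative_field_def)

lemma has_derivative_norm_gram_defect_power2:
  "((\<lambda>X. \<beta> / 4 * (norm (transpose X ** X - mat 1))\<^sup>2) has_derivative
     (\<lambda>H. (\<beta> *\<^sub>R (X ** gram_defect X)) \<bullet> H)) (at X)"
  unfolding power2_norm_eq_inner
  by (rule derivative_eq_intros has_derivative_gram refl)+
    (simp add: fun_eq_iff inner_gram_deriv inner_commute[of "gram_deriv X _"] flip: gram_defect_def)

lemma continuous_on_normal_direction: "continuous_on S (\<lambda>X. \<beta> *\<^sub>R (X ** gram_defect X))"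
  by (intro continuous_intros)

lemma lyapunov_function_penalty:
  assumes "path_differentiable f" "conservative_field D" "admits_potential D f"
  shows "lyapunov_function (penalty_field D \<beta>) (penalty f \<beta>)"
  using lyapunov_function_composite[OF assms has_derivative_\<A> continuous_on_\<J>\<^sub>\<A>
      has_derivative_norm_gram_defect_power2 continuous_on_normal_direction, of \<beta>]
  by (simp add: adjoint_\<J>\<^sub>\<A> penalty_field_def[abs_def] penalty_def[abs_def])

lemma locally_lipschitz_imp_continuous_on:
  assumes "locally_lipschitz f"
  shows "continuous_on S f"
proof (rule continuous_at_imp_continuous_on, intro ballI)
  fix x
  obtain u L where u: "u > 0" "L-lipschitz_on (cball x u) f"
    using assms unfolding locally_lipschitz_def by blast
  have "x \<in> interior (cball x u)" using u(1) centre_in_ball[of x u] ball_subset_cball[of x u]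
    by (meson interiorI open_ball)
  then show "isCont f x"
    by (rule continuous_on_interior[OF lipschitz_on_continuous_on[OF u(2)]])
qed

lemma continuous_on_penalty:
  fixes f :: "real^'p^'n \<Rightarrow> real"
  assumes "locally_lipschitz f"
  shows "continuous_on S (penalty f \<beta>)"
proof -
  have "continuous_on S (\<A> :: real^'p^'n \<Rightarrow> _)" unfolding \<A>_def[abs_def] by (intro continuous_intros)
  then have "continuous_on S (\<lambda>X. f (\<A> X))"
    by (rule continuous_on_compose2[OF locally_lipschitz_imp_continuous_on[OF assms, of UNIV]]) simp
  then show ?thesis unfolding penalty_def[abs_def] by (intro continuous_intros)
qed

lemma penalty_stiefel: "X \<in> stiefel \<Longrightarrow> penalty f \<beta> X = f X"
  by (simp add: penalty_def \<A>_stiefel stiefel_def)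

lemma penalty_field_stiefel: "X \<in> stiefel \<Longrightarrow> penalty_field D \<beta> X = \<J>\<^sub>\<A> X ` D X"
  by (simp add: penalty_field_def \<A>_stiefel mem_stiefel_iff matrix_mult_scaleR)

lemma penalty_field_mean_tendsto:
  assumes "(\<lambda>N. infdist (mean (\<lambda>j. G (r j)) N) (\<J>\<^sub>\<A> x ` D (\<A> x))) \<longlonglongrightarrow> 0"
    and x: "(\<lambda>j. X (r j)) \<longlonglongrightarrow> x"
  shows "(\<lambda>N. infdist (mean (\<lambda>j. G (r j) + \<beta> *\<^sub>R (X (r j) ** gram_defect (X (r j)))) N)
     (penalty_field D \<beta> x)) \<longlonglongrightarrow> 0"
proof -
  have "(\<lambda>j. \<beta> *\<^sub>R (X (r j) ** gram_defect (X (r j)))) \<longlonglongrightarrow> \<beta> *\<^sub>R (x ** gram_defect x)"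
    using continuous_on_tendsto_compose[OF continuous_on_normal_direction[of UNIV \<beta>] x] by simp
  moreover have "penalty_field D \<beta> x = (\<lambda>V. V + \<beta> *\<^sub>R (x ** gram_defect x)) ` \<J>\<^sub>\<A> x ` D (\<A> x)"
    by (simp add: penalty_field_def image_image)
  ultimately show ?thesis using infdist_mean_add_tendsto[OF assms(1)] by simp
qed

text \<open>Pairing the stationarity equation with the normal direction \<open>X c\<close>, \<open>c = gram_defect X\<close>, bounds
  \<open>\<parallel>X c\<parallel>\<close>, which is comparable to \<open>\<parallel>c\<parallel>\<close>, by a multiple of \<open>\<parallel>c\<parallel>\<^sup>2\<close>.\<close>

lemma penalty_field_stationary_imp_stiefel:
  fixes X :: "real^'p^'n"
  assumes X: "X \<in> \<Omega> r" "r \<le> 1/2" and D: "\<And>V. V \<in> D (\<A> X) \<Longrightarrow> 16 * norm V \<le> \<beta>"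
    and \<beta>: "\<beta> > 0" and zero: "0 \<in> penalty_field D \<beta> X"
  shows "X \<in> stiefel"
proof -
  define c where "c = gram_defect X"
  define \<nu> where "\<nu> = norm (X ** c)"
  have norm_c: "norm c \<le> 1/2" using X by (simp add: c_def mem_\<Omega>_iff)
  obtain V where V: "16 * norm V \<le> \<beta>" "\<J>\<^sub>\<A> X V + \<beta> *\<^sub>R (X ** c) = 0"
    using zero D unfolding penalty_field_def c_def by force
  have "\<beta> * \<nu>\<^sup>2 = (X ** c) \<bullet> (\<J>\<^sub>\<A> X V + \<beta> *\<^sub>R (X ** c)) - (X ** c) \<bullet> \<J>\<^sub>\<A> X V"
    by (simp add: inner_add_right \<nu>_def power2_norm_eq_inner)
  also have "\<dots> = - (15/8) * ((X ** c ** (c ** c)) \<bullet> V)"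
    unfolding V(2) \<J>\<^sub>\<A>_symmetric[symmetric] by (simp add: c_def \<J>\<^sub>\<A>_normal)
  also have "\<dots> \<le> (15/8) * (norm (X ** c ** (c ** c)) * norm V)"
    using Cauchy_Schwarz_ineq2[of "X ** c ** (c ** c)" V] by linarith
  also have "\<dots> \<le> (15/8) * ((\<nu> * (norm c * norm c)) * (\<beta> / 16))"
    unfolding \<nu>_def using V(1) by (intro mult_mono norm_matrix_mult_le) auto
  finally have "\<beta> * (\<nu> * \<nu>) \<le> \<beta> * (\<nu> * (15/128 * (norm c)\<^sup>2))" by (simp add: power2_eq_square mult_ac)
  then have "\<nu> * \<nu> \<le> \<nu> * (15/128 * (norm c)\<^sup>2)" using \<beta> by simp
  then have "\<nu> \<le> 15/128 * (norm c)\<^sup>2" by (cases "\<nu> = 0") (auto simp: \<nu>_def)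
  also have "\<dots> \<le> 1/2 * norm c"
    using mult_right_mono[OF norm_c, of "norm c"] norm_ge_zero[of c]
    unfolding power2_eq_square by linarith
  finally have "\<nu>\<^sup>2 \<le> (1/2 * norm c)\<^sup>2" by (intro power_mono) (auto simp: \<nu>_def)
  moreover have "(norm c)\<^sup>2 - norm c * (norm c)\<^sup>2 \<le> \<nu>\<^sup>2"
    using abs_norm_matrix_mult_power2_diff_le[of X c] by (simp add: \<nu>_def c_def abs_le_iff)
  moreover have "norm c * (norm c)\<^sup>2 \<le> 1/2 * (norm c)\<^sup>2" using norm_c by (intro mult_right_mono) auto
  ultimately have "(norm c)\<^sup>2 \<le> 0" by (simp add: power_mult_distrib power2_eq_square)
  then show ?thesis by (simp add: c_def mem_stiefel_iff)
qed

lemma penalty_field_stationary: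
  assumes X: "X \<in> \<Omega> r" "r \<le> 1/2" and D: "\<And>Y V. Y \<in> \<Omega> r \<Longrightarrow> V \<in> D Y \<Longrightarrow> 16 * norm V \<le> \<beta>"
    and \<beta>: "\<beta> > 0" and zero: "0 \<in> penalty_field D \<beta> X"
  shows "X \<in> stiefel \<and> 0 \<in> \<J>\<^sub>\<A> X ` D X"
proof -
  have "\<A> X \<in> \<Omega> r" using X by (intro \<A>_mem_\<Omega>) auto
  then have "X \<in> stiefel" by (rule penalty_field_stationary_imp_stiefel[OF X D \<beta> zero])
  then show ?thesis using zero by (simp add: penalty_field_stiefel)
qed

lemma interior_penalty_critical_values:
  assumes r: "r \<le> 1/2" and D: "\<And>Y V. Y \<in> \<Omega> r \<Longrightarrow> V \<in> D Y \<Longrightarrow> 16 * norm V \<le> \<beta>"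
    and \<beta>: "\<beta> > 0" and crit: "interior {f X |X. X \<in> stiefel \<and> 0 \<in> \<J>\<^sub>\<A> X ` D X} = {}"
  shows "interior (penalty f \<beta> ` {X \<in> \<Omega> r. 0 \<in> penalty_field D \<beta> X}) = {}"
proof -
  have stationary: "X \<in> stiefel \<and> 0 \<in> \<J>\<^sub>\<A> X ` D X" if "X \<in> \<Omega> r" "0 \<in> penalty_field D \<beta> X" for X
    by (rule penalty_field_stationary[OF that(1) r D \<beta> that(2)])
  have "penalty f \<beta> ` {X \<in> \<Omega> r. 0 \<in> penalty_field D \<beta> X} \<subseteq> {f X |X. X \<in> stiefel \<and> 0 \<in> \<J>\<^sub>\<A> X ` D X}"
    by (auto dest!: stationary simp: penalty_stiefel)
  then show ?thesis using interior_mono crit by blast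
qed

lemma gram_defect_gradient_step:
  fixes X U :: "real^'p^'n" and a :: real
  defines "c \<equiv> gram_defect X"
  defines "W \<equiv> (mat 1 - a *\<^sub>R c) ** (transpose X ** U)"
  shows "gram_defect (X - a *\<^sub>R (X ** c) - U) = (1 - 2 * a) *\<^sub>R c - (2 * a - a\<^sup>2) *\<^sub>R (c ** c)
     + a\<^sup>2 *\<^sub>R (c ** c ** c) - W - transpose W + transpose U ** U"
proof -
  define N where "N = mat 1 - a *\<^sub>R c"
  have N: "transpose N = N" by (simp add: N_def c_def transpose_distribs)
  have "X - a *\<^sub>R (X ** c) - U = X ** N - U" by (simp add: N_def matrix_mult_distribs matrix_mult_scaleR)
  then have "gram_defect (X - a *\<^sub>R (X ** c) - U) =
      N ** (transpose X ** X) ** N - W - transpose W + transpose U ** U - mat 1"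
    by (simp add: gram_defect_def W_def matrix_mult_distribs transpose_distribs matrix_transpose_mul N
        matrix_mul_assoc flip: N_def)
  also have "\<dots> = (N ** (mat 1 + c) ** N - mat 1) - W - transpose W + transpose U ** U"
    by (simp add: gram_eq c_def)
  also have "N ** (mat 1 + c) ** N - mat 1 =
      (1 - 2 * a) *\<^sub>R c - (2 * a - a\<^sup>2) *\<^sub>R (c ** c) + a\<^sup>2 *\<^sub>R (c ** c ** c)"
    unfolding N_def
    by (simp only: matrix_mult_expand)
       (simp add: vec_eq_iff algebra_simps power2_eq_square)
  finally show ?thesis .
qed

lemma norm_gram_defect_gradient_step_le:
  fixes X U :: "real^'p^'n"
  defines "c \<equiv> gram_defect X"
  defines "\<kappa> \<equiv> norm c"
  assumes a: "0 \<le> a" "a \<le> 1/2"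
  shows "norm (gram_defect (X - a *\<^sub>R (X ** c) - U)) \<le> (1 - 2 * a) * \<kappa> + (2 * a - a\<^sup>2) * \<kappa>\<^sup>2 + a\<^sup>2 * \<kappa> ^ 3
     + 2 * ((1 + a * \<kappa>) * (sqrt (1 + \<kappa>) * norm U)) + (norm U)\<^sup>2"
proof -
  let ?V = "transpose X ** U"
  let ?W = "(mat 1 - a *\<^sub>R c) ** ?V"
  have coeff_nonneg: "0 \<le> 2 * a - a\<^sup>2" using a mult_right_mono[of a 1 a] by (simp add: power2_eq_square)
  have norm_c2: "norm (c ** c) \<le> \<kappa>\<^sup>2" and norm_c3: "norm (c ** c ** c) \<le> \<kappa> ^ 3"
    unfolding power2_eq_square power3_eq_cube \<kappa>_def by (intro norm_matrix_mult_le order_refl)+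
  have "norm ?W \<le> norm ?V + norm (a *\<^sub>R (c ** ?V))"
    unfolding matrix_mult_distribs matrix_mult_scaleR matrix_mul_lid by (rule norm_triangle_ineq4)
  also have "\<dots> \<le> (1 + a * \<kappa>) * norm ?V"
    using mult_left_mono[OF norm_matrix_mult_le[OF order_refl order_refl, of c ?V], of a] a
    by (simp add: \<kappa>_def algebra_simps)
  also have "\<dots> \<le> (1 + a * \<kappa>) * (sqrt (1 + \<kappa>) * norm U)"
    unfolding \<kappa>_def c_def using a by (intro mult_left_mono norm_transpose_matrix_mult_le) auto
  finally have norm_W: "norm ?W \<le> (1 + a * \<kappa>) * (sqrt (1 + \<kappa>) * norm U)" .
  have norm_UU: "norm (transpose U ** U) \<le> (norm U)\<^sup>2"
    unfolding power2_eq_square by (intro norm_matrix_mult_le) simp_all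
  have "norm (gram_defect (X - a *\<^sub>R (X ** c) - U)) \<le> (1 - 2 * a) * norm c + (2 * a - a\<^sup>2) * norm (c ** c)
      + a\<^sup>2 * norm (c ** c ** c) + norm ?W + norm ?W + norm (transpose U ** U)"
    unfolding c_def gram_defect_gradient_step using a coeff_nonneg
    by (intro norm_triangle_le norm_triangle_le_diff add_mono) auto
  also have "\<dots> \<le> (1 - 2 * a) * \<kappa> + (2 * a - a\<^sup>2) * \<kappa>\<^sup>2 + a\<^sup>2 * \<kappa> ^ 3
     + (1 + a * \<kappa>) * (sqrt (1 + \<kappa>) * norm U) + (1 + a * \<kappa>) * (sqrt (1 + \<kappa>) * norm U) + (norm U)\<^sup>2"
    using a coeff_nonneg
    by (intro add_mono mult_left_mono norm_c2 norm_c3 norm_W norm_UU) (auto simp: \<kappa>_def)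
  finally show ?thesis by linarith
qed

lemma gradient_step_mem_\<Omega>:
  fixes X D :: "real^'p^'n"
  assumes X: "X \<in> \<Omega> (1/6)" and D: "60 * norm D \<le> \<beta>" and \<beta>: "\<beta> > 0"
    and \<eta>: "0 < \<eta>" "\<eta> \<le> 1 / (2 * \<beta>)"
  shows "X - \<eta> *\<^sub>R (D + \<beta> *\<^sub>R (X ** (transpose X ** X - mat 1))) \<in> \<Omega> (1/6)"
proof -
  define c where "c = gram_defect X"
  define \<kappa> where "\<kappa> = norm c"
  define a where "a = \<eta> * \<beta>"
  define u where "u = norm (\<eta> *\<^sub>R D)"
  have \<kappa>: "0 \<le> \<kappa>" "\<kappa> \<le> 1/6" using X by (auto simp: \<kappa>_def c_def mem_\<Omega>_iff)
  have a: "0 \<le> a" "a \<le> 1/2" using \<eta> \<beta> by (auto simp: a_def field_simps)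
  have u: "0 \<le> u" "u \<le> a / 60" using mult_left_mono[OF D, of \<eta>] \<eta> by (auto simp: u_def a_def)
  have powers_le: "(2 * a - a\<^sup>2) * \<kappa>\<^sup>2 + a\<^sup>2 * \<kappa> ^ 3 \<le> 2 * a * (1/36)"
  proof -
    have "a\<^sup>2 * \<kappa> ^ 3 \<le> a\<^sup>2 * \<kappa>\<^sup>2" using \<kappa> by (intro mult_left_mono power_decreasing) auto
    moreover have "2 * a * \<kappa>\<^sup>2 \<le> 2 * a * (1/6)\<^sup>2" using a \<kappa> by (intro mult_left_mono power_mono) auto
    ultimately show ?thesis by (simp add: algebra_simps power2_eq_square)
  qed
  have cross_le: "(1 + a * \<kappa>) * (sqrt (1 + \<kappa>) * u) \<le> 2 * (2 * u)"
    using a \<kappa> u mult_mono[of a 1 \<kappa> 1] by (intro mult_mono real_le_lsqrt) auto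
  have "u\<^sup>2 \<le> u" using u a mult_left_mono[of u 1 u] by (simp add: power2_eq_square)
  moreover have "(1 - 2 * a) * \<kappa> \<le> (1 - 2 * a) * (1/6)" using a \<kappa> by (intro mult_left_mono) auto
  moreover have "norm (gram_defect (X - a *\<^sub>R (X ** c) - \<eta> *\<^sub>R D)) \<le>
      (1 - 2 * a) * \<kappa> + (2 * a - a\<^sup>2) * \<kappa>\<^sup>2 + a\<^sup>2 * \<kappa> ^ 3 + 2 * ((1 + a * \<kappa>) * (sqrt (1 + \<kappa>) * u)) + u\<^sup>2"
    unfolding c_def \<kappa>_def u_def by (rule norm_gram_defect_gradient_step_le[OF a])
  ultimately have "norm (gram_defect (X - a *\<^sub>R (X ** c) - \<eta> *\<^sub>R D)) \<le> 1/6"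
    using powers_le cross_le u a by (simp add: algebra_simps)
  then show ?thesis
    by (simp add: mem_\<Omega>_iff a_def c_def gram_defect_def algebra_simps)
qed

lemma penalty_iterates_mem_\<Omega>:
  assumes "X 0 \<in> \<Omega> (1/6)"
    and iter: "\<And>k. X (Suc k) = X k - \<eta> k *\<^sub>R (D k + \<beta> *\<^sub>R (X k ** (transpose (X k) ** X k - mat 1)))"
    and D: "\<And>k. 60 * norm (D k) \<le> \<beta>" and \<beta>: "\<beta> > 0"
    and \<eta>: "\<And>k. 0 < \<eta> k" "\<And>k. \<eta> k \<le> 1 / (2 * \<beta>)"
  shows "X k \<in> \<Omega> (1/6)"
  by (induction k) (use assms(1) iter in \<open>auto intro!: gradient_step_mem_\<Omega> D \<beta> \<eta>\<close>)

text \<open>Absorbing the tail of the convergent noise series into the iterates removes the noise.\<close>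

lemma noise_free_shift:
  fixes X U E :: "nat \<Rightarrow> 'a::real_normed_vector"
  assumes "convergent (\<lambda>N. \<Sum>k\<le>N. \<eta> k *\<^sub>R E k)"
    and X: "\<And>k. X (Suc k) = X k - \<eta> k *\<^sub>R (U k + E k)"
  shows "\<exists>Y. (\<lambda>k. Y k - X k) \<longlonglongrightarrow> 0 \<and> (\<forall>k. Y (Suc k) = Y k - \<eta> k *\<^sub>R U k)"
proof -
  obtain L where L: "(\<lambda>N. \<Sum>k\<le>N. \<eta> k *\<^sub>R E k) \<longlonglongrightarrow> L"
    using assms(1) by (auto simp: convergent_def)
  define Z where "Z n = (\<Sum>k<n. \<eta> k *\<^sub>R E k)" for n
  have "(\<lambda>n. Z (Suc n)) \<longlonglongrightarrow> L" using L by (simp add: Z_def lessThan_Suc_atMost)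
  then have "Z \<longlonglongrightarrow> L" by (simp add: filterlim_sequentially_Suc)
  then have "(\<lambda>k. (X k + (Z k - L)) - X k) \<longlonglongrightarrow> 0" using LIM_zero by simp
  moreover have "X (Suc k) + (Z (Suc k) - L) = X k + (Z k - L) - \<eta> k *\<^sub>R U k" for k
    by (simp add: Z_def X algebra_simps)
  ultimately show ?thesis by (intro exI[of _ "\<lambda>k. X k + (Z k - L)"]) blast
qed

theorem theorem4p12:
  fixes f :: "real^'p^'n \<Rightarrow> real"
    and D\<^sub>f :: "real^'p^'n \<Rightarrow> (real^'p^'n) set"
    and X D G E :: "nat \<Rightarrow> real^'p^'n"
    and \<eta> :: "nat \<Rightarrow> real"
    and \<beta> Mtilde Mhat :: real
  assumes lip: "locally_lipschitz f"
    and A1: "path_differentiable f"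
    and A2: "interior {f X |X. X \<in> stiefel \<and> 0 \<in> projected_subdiff f X} = {}"
    and cons: "conservative_field D\<^sub>f"
    and pot: "admits_potential D\<^sub>f f"
    and beta_pos: "\<beta> > 0"
    and init: "X 0 \<in> \<Omega> (1/6)"
    and iter: "\<And>k. X (Suc k) =
                 X k - \<eta> k *\<^sub>R (D k + \<beta> *\<^sub>R (X k ** (transpose (X k) ** X k - mat 1)))"
    and C1_split: "\<And>k. D k = G k + E k"
    and C1_noise: "convergent (\<lambda>N. \<Sum>k\<le>N. \<eta> k *\<^sub>R E k)"
    and C1_avg: "\<And>r Xt. strict_mono (r :: nat \<Rightarrow> nat) \<Longrightarrow> (\<lambda>j. X (r j)) \<longlonglongrightarrow> Xt \<Longrightarrow>
                   (\<lambda>N. infdist ((1 / real N) *\<^sub>R (\<Sum>j<N. G (r j))) (\<J>\<^sub>\<A> Xt ` D\<^sub>f (\<A> Xt))) \<longlonglongrightarrow> 0"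
    and C2_D: "\<And>k. norm (D k) \<le> Mtilde"
    and C2_Df: "\<And>Y V. Y \<in> \<Omega> (1/6) \<Longrightarrow> V \<in> D\<^sub>f Y \<Longrightarrow> norm V \<le> Mhat"
    and C2_beta: "\<beta> \<ge> Max {16 * M\<^sub>1 f, 60 * Mtilde, 16 * Mhat}"
    and C3_pos: "\<And>k. \<eta> k > 0"
    and C3_sum: "filterlim (\<lambda>N. \<Sum>k\<le>N. \<eta> k) at_top sequentially"
    and C3_sq: "summable (\<lambda>k. (\<eta> k)\<^sup>2)"
    and C3_bound: "\<And>k. \<eta> k \<le> 1 / (2 * \<beta>)"
    and C4: "interior {f X |X. X \<in> stiefel \<and> 0 \<in> \<J>\<^sub>\<A> X ` D\<^sub>f X} = {}"
  shows "convergent (\<lambda>k. penalty f \<beta> (X k)) \<and>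
         (\<forall>Xs. (\<exists>r :: nat \<Rightarrow> nat. strict_mono r \<and> (\<lambda>j. X (r j)) \<longlonglongrightarrow> Xs) \<longrightarrow>
            Xs \<in> {X \<in> stiefel. 0 \<in> \<J>\<^sub>\<A> X ` D\<^sub>f X})"
proof -
  define U where "U k = G k + \<beta> *\<^sub>R (X k ** gram_defect (X k))" for k
  have "X (Suc k) = X k - \<eta> k *\<^sub>R (U k + E k)" for k
    by (simp add: iter C1_split U_def gram_defect_def algebra_simps)
  then obtain Y where Y: "(\<lambda>k. Y k - X k) \<longlonglongrightarrow> 0" "\<And>k. Y (Suc k) = Y k - \<eta> k *\<^sub>R U k"
    using noise_free_shift[OF C1_noise] by blast
  have D_le: "60 * norm (D k) \<le> \<beta>" for k using C2_D[of k] C2_beta by simp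
  have D\<^sub>f_le: "16 * norm V \<le> \<beta>" if "x \<in> \<Omega> (1/6)" "V \<in> D\<^sub>f x" for x V
    using C2_Df[OF that] C2_beta by simp
  interpret lyapunov_recursion \<eta> X Y U "penalty_field D\<^sub>f \<beta>" "\<Omega> (1/6)" "penalty f \<beta>"
  proof
    show "X k \<in> \<Omega> (1/6)" for k
      by (rule penalty_iterates_mem_\<Omega>[OF init iter D_le beta_pos C3_pos C3_bound])
    show "\<eta> \<longlonglongrightarrow> 0" using summable_LIMSEQ_zero[OF C3_sq] by simp
    show "filterlim (\<lambda>n. \<Sum>k<n. \<eta> k) at_top sequentially"
      using C3_sum filterlim_sequentially_Suc[of "\<lambda>n. \<Sum>k<n. \<eta> k"] by (simp add: lessThan_Suc_atMost)
    show "(\<lambda>N. infdist (mean (\<lambda>j. U (r j)) N) (penalty_field D\<^sub>f \<beta> x)) \<longlonglongrightarrow> 0"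
      if "strict_mono r" "(\<lambda>j. X (r j)) \<longlonglongrightarrow> x" for r :: "nat \<Rightarrow> nat" and x
      unfolding U_def by (intro penalty_field_mean_tendsto C1_avg[folded mean_def] that)
    show "interior (penalty f \<beta> ` {x \<in> \<Omega> (1/6). 0 \<in> penalty_field D\<^sub>f \<beta> x}) = {}"
      by (rule interior_penalty_critical_values[OF _ D\<^sub>f_le beta_pos C4]) simp
  qed (simp_all add: C3_pos Y compact_\<Omega> compact_penalty_field[OF cons] penalty_field_nonempty[OF cons]
      continuous_on_penalty[OF lip] lyapunov_function_penalty[OF A1 cons pot])
  have "x \<in> stiefel \<and> 0 \<in> \<J>\<^sub>\<A> x ` D\<^sub>f x" if "strict_mono r" "(\<lambda>j. X (r j)) \<longlonglongrightarrow> x" for r x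
    using cluster_point_stationary[OF that]
    by (intro penalty_field_stationary[OF _ _ D\<^sub>f_le beta_pos]) auto
  then show ?thesis using convergent_h_X by blast
qed

end
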